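(* Let $\gamma>0$ and let $N,I,J\ge 1$ be integers. The following three particle formulations are affine invariant: (1) the mean-field equation $$\dot q=p,\qquad \dot p=-\mathcal{C}_q(\rho)D\Phi(q)-\gamma p+\sqrt{2\gamma\,\mathcal{C}_q(\rho)}\,\dot W;$$ (2) the ensemble approximation, for $i=1,\dots,I$, $$\dot q^{(i)}=p^{(i)},\qquad \dot p^{(i)}=-C_q(Z)D\Phi(q^{(i)})-\gamma p^{(i)}+\sqrt{2\gamma\, C_q(Z)}\,\dot W^{(i)};$$ (3) the gradient-free approximation, for $i=1,\dots,I$, $$\dot q^{(i)}=p^{(i)},\qquad \dot p^{(i)}=-C_q(Z)\Gamma_0^{-1}q^{(i)}-\frac1I\sum_{k=1}^I\langle\mathcal{G}(q^{(k)})-\bar{\mathcal{G}},\ \mathcal{G}(q^{(i)})-y\rangle_\Gamma\, q^{(k)}-\gamma p^{(i)}+\sqrt{2\gamma\, C_q(Z)}\,\dot W^{(i)}.$$ Moreover, the Fokker--Planck equation $$\partial_t\rho=\nabla\cdot\bigl((\mathcal{K}-\mathcal{J})(\rho\nabla\mathcal{H}+\nabla\rho)\bigr),\qquad \mathcal{J}=\begin{pmatrix}0&\mathcal{C}_q(\rho)\\-\mathcal{C}_q(\rho)&0\end{pmatrix},\quad \mathcal{K}=\begin{pmatrix}0&0\\0&\gamma\,\mathcal{C}_q(\rho)\end{pmatrix},$$ with $\mathcal{H}(q,p)=\frac12\langle p,\mathcal{C}_q(\rho)^{-1}p\rangle+\Phi(q)$, is affine invariant.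
   Context: **Notation.** $q,p,q^{(i)},p^{(i)}\in\mathbb{R}^N$, and $\Phi:\mathbb{R}^N\to\mathbb{R}$ is a differentiable potential. In (1), $\rho$ is the law of $z=(q,p)$ and $\mathcal{C}_q(\rho)$ is the covariance matrix of its $q$-marginal (assumed invertible where its inverse appears); $\sqrt{\mathcal{C}}$ denotes a generalized square root, i.e. a matrix $S$ with $SS^T=\mathcal{C}$ (the choice does not affect the law of the dynamics), and $W$ is a standard Brownian motion. In (2) and (3), $Z=\{(q^{(i)},p^{(i)})\}_{i=1}^I$, $\bar q=\frac1I\sum_{i}q^{(i)}$, $Q=(q^{(1)}-\bar q,\dots,q^{(I)}-\bar q)\in\mathbb{R}^{N\times I}$, $C_q(Z)=\frac1I QQ^T$, $\sqrt{C_q(Z)}:=\frac{1}{\sqrt I}Q$, so $\sqrt{2\gamma C_q(Z)}=\sqrt{2\gamma/I}\,Q$, and the $W^{(i)}$ are independent standard Brownian motions in $\mathbb{R}^I$. In (3), $\mathcal{G}:\mathbb{R}^N\to\mathbb{R}^J$ is a map, $y\in\mathbb{R}^J$, $\Gamma\in\mathbb{R}^{J\times J}$ and $\Gamma_0\in\mathbb{R}^{N\times N}$ are symmetric positive definite, $\bar{\mathcal{G}}=\frac1I\sum_k\mathcal{G}(q^{(k)})$, $\langle a,b\rangle_\Gamma=\langle a,\Gamma^{-1}b\rangle$, $\|a\|_\Gamma^2=\langle a,a\rangle_\Gamma$, and the potential is $\Phi(q)=\frac12\|y-\mathcal{G}(q)\|_\Gamma^2+\frac12\|q\|_{\Gamma_0}^2$.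 **Affine invariance of a particle formulation.** For every invertible $A\in\mathbb{R}^{N\times N}$ and $b\in\mathbb{R}^N$, under the change of variables $q^{(i)}=Av^{(i)}+b$, $p^{(i)}=Au^{(i)}$ (in the mean-field case, without superscripts), the equations satisfied by $(v^{(i)},u^{(i)})$ are the same equations with $q^{(i)},p^{(i)}$ replaced by $v^{(i)},u^{(i)}$ (including in the empirical or mean-field covariance and its generalized square root) and with $\Phi$ replaced by $\tilde\Phi(v)=\Phi(Av+b)$. In (1), the generalized square root of the covariance of $v$ is allowed to be $A^{-1}$ times that of the covariance of $q$. In (3), replacing $\Phi$ by $\tilde\Phi$ means replacing $\mathcal{G}$ by $\tilde{\mathcal{G}}(v)=\mathcal{G}(Av+b)$ and replacing the term $C_q(Z)\Gamma_0^{-1}q^{(i)}=C_q(Z)\,DR(q^{(i)})$, where $R(q)=\frac12\|q\|_{\Gamma_0}^2$, by $C_v\,D\tilde R(v^{(i)})$ with $\tilde R(v)=R(Av+b)$, where $C_v$ is the empirical covariance of the $v^{(i)}$. **Affine invariance of the Fokker--Planck equation.** For every invertible $A$ and every $b$, under $q=Av+b$, $p=Au$, the density $\tilde\rho(v,u,t)=|\det A|^2\rho(Av+b,Au,t)$ of the transformed variables satisfies the same equation as $\rho$, with $(q,p)$ replaced by $(v,u)$ (so $\mathcal{C}_q(\rho)$ is replaced by the covariance $\mathcal{C}_v(\tilde\rho)$ of the $v$-marginal of $\tilde\rho$) and with $\mathcal{H}$ replaced by $\tilde{\mathcal{H}}(v,u)=\mathcal{H}(Av+b,Au)$. *)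

theory Defs
  imports "HOL-Probability.Probability"
begin

section \<open>Gradient, symmetric positive definite matrices, weighted inner products\<close>

definition gradient :: "('a::real_inner \<Rightarrow> real) \<Rightarrow> 'a \<Rightarrow> 'a" where
  "gradient f x = (THE D. GDERIV f x :> D)"

definition symmetric_positive_definite :: "real^'n^'n \<Rightarrow> bool" where
  "symmetric_positive_definite B \<longleftrightarrow>
     transpose B = B \<and> (\<forall>x. x \<noteq> 0 \<longrightarrow> 0 < x \<bullet> (B *v x))"

definition weighted_inner :: "real^'n^'n \<Rightarrow> real^'n \<Rightarrow> real^'n \<Rightarrow> real" where
  "weighted_inner B a b = a \<bullet> (matrix_inv B *v b)"

section \<open>Brownian motion\<close>

text \<open>Time is indexed by \<^typ>\<open>real\<close>; only nonnegative times are used.\<close>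

definition filtered_prob_space :: "'w measure \<Rightarrow> (real \<Rightarrow> 'w measure) \<Rightarrow> bool" where
  "filtered_prob_space M F \<longleftrightarrow>
     prob_space M \<and> filtration (space M) F \<and> (\<forall>t. subalgebra M (F t))"

definition standard_brownian_motion ::
    "'w measure \<Rightarrow> (real \<Rightarrow> 'w measure) \<Rightarrow> (real \<Rightarrow> 'w \<Rightarrow> real^'m) \<Rightarrow> bool" where
  "standard_brownian_motion M F W \<longleftrightarrow>
     (\<forall>t\<ge>0. W t \<in> borel_measurable (F t)) \<and>
     (AE \<omega> in M. W 0 \<omega> = 0 \<and> continuous_on {0..} (\<lambda>t. W t \<omega>)) \<and>
     (\<forall>s t. 0 \<le> s \<and> s < t \<longrightarrow>
        prob_space.indep_set M (sets (F s))
          {(\<lambda>\<omega>. W t \<omega> - W s \<omega>) -` B \<inter> space M |B. B \<in> sets borel} \<and>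
        prob_space.indep_vars M (\<lambda>_. borel) (\<lambda>k \<omega>. (W t \<omega> - W s \<omega>) $ k) UNIV \<and>
        (\<forall>k. distributed M lborel (\<lambda>\<omega>. (W t \<omega> - W s \<omega>) $ k)
               (normal_density 0 (sqrt (t - s)))))"

definition independent_brownian_motions ::
    "'w measure \<Rightarrow> (real \<Rightarrow> 'w measure) \<Rightarrow> ('i \<Rightarrow> real \<Rightarrow> 'w \<Rightarrow> real^'m) \<Rightarrow> bool" where
  "independent_brownian_motions M F W \<longleftrightarrow>
     (\<forall>i. standard_brownian_motion M F (W i)) \<and>
     prob_space.indep_vars M (\<lambda>_. PiM {0..} (\<lambda>_. borel))
       (\<lambda>i \<omega>. restrict (\<lambda>t. W i t \<omega>) {0..}) UNIV"

section \<open>Stochastic integral\<close>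

text \<open>Simple predictable integrands: on the interval from \<open>\<tau> k\<close> (excluded) to
  \<open>\<tau> (Suc k)\<close> (included), \<open>k < m\<close>, the value is the bounded random matrix \<open>\<xi> k\<close>,
  measurable at time \<open>\<tau> k\<close>.\<close>

definition simple_integrand ::
    "'w measure \<Rightarrow> (real \<Rightarrow> 'w measure) \<Rightarrow> nat \<Rightarrow> (nat \<Rightarrow> real) \<Rightarrow> (nat \<Rightarrow> 'w \<Rightarrow> real^'m^'n) \<Rightarrow> bool"
  where
  "simple_integrand M F m \<tau> \<xi> \<longleftrightarrow>
     0 \<le> \<tau> 0 \<and> incseq \<tau> \<and>
     (\<forall>k<m. \<xi> k \<in> borel_measurable (F (\<tau> k)) \<and> bounded (\<xi> k ` space M))"

definition step_process ::
    "nat \<Rightarrow> (nat \<Rightarrow> real) \<Rightarrow> (nat \<Rightarrow> 'w \<Rightarrow> real^'m^'n) \<Rightarrow> real \<Rightarrow> 'w \<Rightarrow> real^'m^'n" where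
  "step_process m \<tau> \<xi> s \<omega> = (\<Sum>k<m. indicator {\<tau> k<..\<tau> (Suc k)} s *\<^sub>R \<xi> k \<omega>)"

definition step_integral ::
    "(real \<Rightarrow> 'w \<Rightarrow> real^'m) \<Rightarrow> nat \<Rightarrow> (nat \<Rightarrow> real) \<Rightarrow> (nat \<Rightarrow> 'w \<Rightarrow> real^'m^'n)
       \<Rightarrow> real \<Rightarrow> 'w \<Rightarrow> real^'n" where
  "step_integral W m \<tau> \<xi> t \<omega> =
     (\<Sum>k<m. \<xi> k \<omega> *v (W (min (\<tau> (Suc k)) t) \<omega> - W (min (\<tau> k) t) \<omega>))"

text \<open>\<open>X\<close> is a version of the Ito integral of \<open>H\<close> against \<open>W\<close> over the interval from 0 to \<open>t\<close>:
  \<open>H\<close> is progressively measurable and is approximated by simple integrands in the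
  (Frobenius) L2 norm in time, in probability, while their elementary integrals converge to \<open>X\<close>
  in probability. Almost sure square integrability of \<open>H\<close> in time is implied.\<close>

definition has_ito_integral ::
    "'w measure \<Rightarrow> (real \<Rightarrow> 'w measure) \<Rightarrow> (real \<Rightarrow> 'w \<Rightarrow> real^'m) \<Rightarrow> real
       \<Rightarrow> (real \<Rightarrow> 'w \<Rightarrow> real^'m^'n) \<Rightarrow> ('w \<Rightarrow> real^'n) \<Rightarrow> bool" where
  "has_ito_integral M F W t H X \<longleftrightarrow>
     (\<forall>r\<in>{0..t}. (\<lambda>(s, \<omega>). H s \<omega>) \<in> borel_measurable (restrict_space borel {0..r} \<Otimes>\<^sub>M F r)) \<and>
     X \<in> borel_measurable M \<and>
     (\<exists>m \<tau> \<xi>. (\<forall>j. simple_integrand M F (m j) (\<tau> j) (\<xi> j)) \<and>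
       (\<forall>\<epsilon>>0. (\<lambda>j::nat. measure M {\<omega> \<in> space M. ennreal \<epsilon> <
            (\<integral>\<^sup>+ s\<in>{0..t}. ennreal ((norm (step_process (m j) (\<tau> j) (\<xi> j) s \<omega> - H s \<omega>))\<^sup>2) \<partial>lborel)})
          \<longlonglongrightarrow> 0) \<and>
       (\<forall>\<epsilon>>0. (\<lambda>j. measure M {\<omega> \<in> space M. \<epsilon> <
            norm (step_integral W (m j) (\<tau> j) (\<xi> j) t \<omega> - X \<omega>)}) \<longlonglongrightarrow> 0))"

section \<open>Second-order dynamics\<close>

text \<open>The equations \<open>q' = p\<close>, \<open>p' = f + \<sigma> W'\<close> on the time interval from 0 to \<open>T\<close>, where \<open>f\<close> and \<open>\<sigma>\<close>
  are the drift and diffusion evaluated along the solution.\<close>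

definition second_order_sde ::
    "'w measure \<Rightarrow> (real \<Rightarrow> 'w measure) \<Rightarrow> (real \<Rightarrow> 'w \<Rightarrow> real^'m) \<Rightarrow> real
       \<Rightarrow> (real \<Rightarrow> 'w \<Rightarrow> real^'n) \<Rightarrow> (real \<Rightarrow> 'w \<Rightarrow> real^'m^'n)
       \<Rightarrow> (real \<Rightarrow> 'w \<Rightarrow> real^'n) \<Rightarrow> (real \<Rightarrow> 'w \<Rightarrow> real^'n) \<Rightarrow> bool" where
  "second_order_sde M F W T f \<sigma> q p \<longleftrightarrow>
     (\<forall>t\<in>{0..T}. q t \<in> borel_measurable (F t) \<and> p t \<in> borel_measurable (F t)) \<and>
     (AE \<omega> in M. continuous_on {0..T} (\<lambda>t. p t \<omega>)) \<and>
     (AE \<omega> in M. \<forall>t\<in>{0..T}.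
        ((\<lambda>s. q s \<omega>) has_vector_derivative p t \<omega>) (at t within {0..T})) \<and>
     (\<exists>Y. (\<forall>t\<in>{0..T}. has_ito_integral M F W t \<sigma> (Y t)) \<and>
        (AE \<omega> in M. \<forall>t\<in>{0..T}.
           set_integrable lborel {0..t} (\<lambda>s. f s \<omega>) \<and>
           p t \<omega> = p 0 \<omega> + (LINT s:{0..t}|lborel. f s \<omega>) + Y t \<omega>))"

text \<open>The drift common to the mean-field equation and its ensemble approximation,
  for a given covariance matrix \<open>C\<close>.\<close>

definition langevin_drift ::
    "real \<Rightarrow> (real^'n \<Rightarrow> real) \<Rightarrow> real^'n^'n \<Rightarrow> real^'n \<Rightarrow> real^'n \<Rightarrow> real^'n" where
  "langevin_drift \<gamma> \<Phi> C q p = - (C *v gradient \<Phi> q) - \<gamma> *\<^sub>R p"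

section \<open>The mean-field equation\<close>

definition finite_second_moment :: "(real^'n) measure \<Rightarrow> bool" where
  "finite_second_moment \<mu> \<longleftrightarrow> integrable \<mu> (\<lambda>x. (norm x)\<^sup>2)"

definition covariance :: "(real^'n) measure \<Rightarrow> real^'n^'n" where
  "covariance \<mu> = (\<chi> i j. \<integral>x. (x $ i - (\<integral>y. y $ i \<partial>\<mu>)) * (x $ j - (\<integral>y. y $ j \<partial>\<mu>)) \<partial>\<mu>)"

definition q_marginal :: "((real^'n) \<times> (real^'n)) measure \<Rightarrow> (real^'n) measure" where
  "q_marginal \<rho> = distr \<rho> borel fst"

definition law_z ::
    "'w measure \<Rightarrow> (real \<Rightarrow> 'w \<Rightarrow> real^'n) \<Rightarrow> (real \<Rightarrow> 'w \<Rightarrow> real^'n) \<Rightarrow> real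
       \<Rightarrow> ((real^'n) \<times> (real^'n)) measure" where
  "law_z M q p t = distr M borel (\<lambda>\<omega>. (q t \<omega>, p t \<omega>))"

text \<open>\<open>S t\<close> is the chosen generalized square root of the covariance at time \<open>t\<close>. It may be
  rectangular, in which case \<open>W\<close> has the matching dimension.\<close>

definition mean_field_solution ::
    "real \<Rightarrow> (real^'n \<Rightarrow> real) \<Rightarrow> (real \<Rightarrow> real^'m^'n)
       \<Rightarrow> 'w measure \<Rightarrow> (real \<Rightarrow> 'w measure) \<Rightarrow> (real \<Rightarrow> 'w \<Rightarrow> real^'m) \<Rightarrow> real
       \<Rightarrow> (real \<Rightarrow> 'w \<Rightarrow> real^'n) \<Rightarrow> (real \<Rightarrow> 'w \<Rightarrow> real^'n) \<Rightarrow> bool" where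
  "mean_field_solution \<gamma> \<Phi> S M F W T q p \<longleftrightarrow>
     (let \<mu> = (\<lambda>t. q_marginal (law_z M q p t)) in
       filtered_prob_space M F \<and> standard_brownian_motion M F W \<and>
       (\<forall>t\<in>{0..T}. finite_second_moment (\<mu> t) \<and> S t ** transpose (S t) = covariance (\<mu> t)) \<and>
       second_order_sde M F W T
         (\<lambda>t \<omega>. langevin_drift \<gamma> \<Phi> (covariance (\<mu> t)) (q t \<omega>) (p t \<omega>))
         (\<lambda>t \<omega>. sqrt (2 * \<gamma>) *\<^sub>R S t) q p)"

section \<open>The interacting particle systems\<close>

text \<open>A configuration is a family of vectors indexed by a finite type \<open>'i\<close> of particles.\<close>

definition ensemble_mean :: "('i::finite \<Rightarrow> real^'n) \<Rightarrow> real^'n" where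
  "ensemble_mean x = (1 / real CARD('i)) *\<^sub>R (\<Sum>i\<in>UNIV. x i)"

definition deviation_matrix :: "('i::finite \<Rightarrow> real^'n) \<Rightarrow> real^'i^'n" where
  "deviation_matrix x = (\<chi> r i. (x i - ensemble_mean x) $ r)"

definition ensemble_covariance :: "('i::finite \<Rightarrow> real^'n) \<Rightarrow> real^'n^'n" where
  "ensemble_covariance x =
     (1 / real CARD('i)) *\<^sub>R (deviation_matrix x ** transpose (deviation_matrix x))"

definition ensemble_sqrt_covariance :: "('i::finite \<Rightarrow> real^'n) \<Rightarrow> real^'i^'n" where
  "ensemble_sqrt_covariance x = (1 / sqrt (real CARD('i))) *\<^sub>R deviation_matrix x"

text \<open>A system of particles, in which \<open>drift x i p\<close> is the drift of the momentum \<open>p\<close> of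
  particle \<open>i\<close> when the positions are \<open>x\<close>.\<close>

definition particle_solution ::
    "real \<Rightarrow> (('i \<Rightarrow> real^'n) \<Rightarrow> 'i \<Rightarrow> real^'n \<Rightarrow> real^'n)
       \<Rightarrow> 'w measure \<Rightarrow> (real \<Rightarrow> 'w measure) \<Rightarrow> ('i::finite \<Rightarrow> real \<Rightarrow> 'w \<Rightarrow> real^'i) \<Rightarrow> real
       \<Rightarrow> ('i \<Rightarrow> real \<Rightarrow> 'w \<Rightarrow> real^'n) \<Rightarrow> ('i \<Rightarrow> real \<Rightarrow> 'w \<Rightarrow> real^'n) \<Rightarrow> bool" where
  "particle_solution \<gamma> drift M F W T q p \<longleftrightarrow>
     filtered_prob_space M F \<and> independent_brownian_motions M F W \<and>
     (\<forall>i. second_order_sde M F (W i) T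
        (\<lambda>t \<omega>. drift (\<lambda>k. q k t \<omega>) i (p i t \<omega>))
        (\<lambda>t \<omega>. sqrt (2 * \<gamma>) *\<^sub>R ensemble_sqrt_covariance (\<lambda>k. q k t \<omega>)) (q i) (p i))"

definition ensemble_drift ::
    "real \<Rightarrow> (real^'n \<Rightarrow> real) \<Rightarrow> ('i::finite \<Rightarrow> real^'n) \<Rightarrow> 'i \<Rightarrow> real^'n \<Rightarrow> real^'n" where
  "ensemble_drift \<gamma> \<Phi> x i p = langevin_drift \<gamma> \<Phi> (ensemble_covariance x) (x i) p"

text \<open>The gradient-free drift, with \<open>g\<close> the gradient field of the regularization term.\<close>

definition gradient_free_drift ::
    "real \<Rightarrow> real^'j^'j \<Rightarrow> real^'j \<Rightarrow> (real^'n \<Rightarrow> real^'j) \<Rightarrow> (real^'n \<Rightarrow> real^'n)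
       \<Rightarrow> ('i::finite \<Rightarrow> real^'n) \<Rightarrow> 'i \<Rightarrow> real^'n \<Rightarrow> real^'n" where
  "gradient_free_drift \<gamma> \<Gamma> y G g x i p =
     - (ensemble_covariance x *v g (x i))
     - (1 / real CARD('i)) *\<^sub>R
         (\<Sum>k\<in>UNIV. weighted_inner \<Gamma> (G (x k) - ensemble_mean (\<lambda>l. G (x l))) (G (x i) - y) *\<^sub>R x k)
     - \<gamma> *\<^sub>R p"

definition regularization :: "real^'n^'n \<Rightarrow> real^'n \<Rightarrow> real" where
  "regularization \<Gamma>\<^sub>0 q = 1 / 2 * weighted_inner \<Gamma>\<^sub>0 q q"

section \<open>The Fokker--Planck equation\<close>

definition density_covariance :: "((real^'n) \<times> (real^'n) \<Rightarrow> real) \<Rightarrow> real^'n^'n" where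
  "density_covariance \<rho> = covariance (q_marginal (density lborel \<rho>))"

text \<open>The block matrix with rows \<open>(A, B)\<close> and \<open>(C, D)\<close>, acting on \<open>(x, y)\<close>.\<close>

definition block_matrix ::
    "real^'n^'n \<Rightarrow> real^'n^'n \<Rightarrow> real^'n^'n \<Rightarrow> real^'n^'n \<Rightarrow> (real^'n) \<times> (real^'n) \<Rightarrow> (real^'n) \<times> (real^'n)"
  where
  "block_matrix A B C D = (\<lambda>(x, y). (A *v x + B *v y, C *v x + D *v y))"

definition fp_J :: "real^'n^'n \<Rightarrow> (real^'n) \<times> (real^'n) \<Rightarrow> (real^'n) \<times> (real^'n)" where
  "fp_J C = block_matrix 0 C (- C) 0"

definition fp_K :: "real \<Rightarrow> real^'n^'n \<Rightarrow> (real^'n) \<times> (real^'n) \<Rightarrow> (real^'n) \<times> (real^'n)" where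
  "fp_K \<gamma> C = block_matrix 0 0 0 (\<gamma> *\<^sub>R C)"

text \<open>The vector field \<open>(K - J) (\<rho> \<nabla>H + \<nabla>\<rho>)\<close> at a fixed time.\<close>

definition fp_flux ::
    "real \<Rightarrow> ((real^'n) \<times> (real^'n) \<Rightarrow> real) \<Rightarrow> ((real^'n) \<times> (real^'n) \<Rightarrow> real)
       \<Rightarrow> (real^'n) \<times> (real^'n) \<Rightarrow> (real^'n) \<times> (real^'n)" where
  "fp_flux \<gamma> H \<rho> z =
     (let C = density_covariance \<rho>; w = \<rho> z *\<^sub>R gradient H z + gradient \<rho> z
      in fp_K \<gamma> C w - fp_J C w)"

text \<open>The divergence of a field \<open>(V\<^sub>q, V\<^sub>p)\<close> is the sum of the divergence of \<open>V\<^sub>q\<close> in \<open>q\<close> and that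
  of \<open>V\<^sub>p\<close> in \<open>p\<close>. Only these two partial derivatives are required to exist: the potential is
  merely differentiable, so the full derivative of the flux need not exist.\<close>

definition block_differentiable ::
    "((real^'n) \<times> (real^'n) \<Rightarrow> (real^'n) \<times> (real^'n)) \<Rightarrow> (real^'n) \<times> (real^'n) \<Rightarrow> bool" where
  "block_differentiable V z \<longleftrightarrow>
     (\<lambda>x. fst (V (x, snd z))) differentiable at (fst z) \<and>
     (\<lambda>y. snd (V (fst z, y))) differentiable at (snd z)"

definition divergence ::
    "((real^'n) \<times> (real^'n) \<Rightarrow> (real^'n) \<times> (real^'n)) \<Rightarrow> (real^'n) \<times> (real^'n) \<Rightarrow> real" where
  "divergence V z =
     trace (jacobian (\<lambda>x. fst (V (x, snd z))) (at (fst z))) +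
     trace (jacobian (\<lambda>y. snd (V (fst z, y))) (at (snd z)))"

text \<open>Classical solutions, in the class of probability densities with finite second moment in \<open>q\<close>
  and invertible covariance. The Hamiltonian \<open>H t\<close> depends on time, through the density.\<close>

definition fokker_planck_solution ::
    "real \<Rightarrow> (real \<Rightarrow> (real^'n) \<times> (real^'n) \<Rightarrow> real) \<Rightarrow> real
       \<Rightarrow> (real \<Rightarrow> (real^'n) \<times> (real^'n) \<Rightarrow> real) \<Rightarrow> bool" where
  "fokker_planck_solution \<gamma> H T \<rho> \<longleftrightarrow>
     (\<forall>t\<in>{0<..<T}.
        (\<forall>z. 0 \<le> \<rho> t z) \<and> \<rho> t \<in> borel_measurable borel \<and>
        prob_space (density lborel (\<rho> t)) \<and>
        finite_second_moment (q_marginal (density lborel (\<rho> t))) \<and>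
        invertible (density_covariance (\<rho> t)) \<and>
        (\<forall>z. \<rho> t differentiable at z \<and> H t differentiable at z \<and>
             block_differentiable (fp_flux \<gamma> (H t) (\<rho> t)) z \<and>
             ((\<lambda>s. \<rho> s z) has_real_derivative divergence (fp_flux \<gamma> (H t) (\<rho> t)) z) (at t)))"

definition hamiltonian ::
    "(real^'n \<Rightarrow> real) \<Rightarrow> ((real^'n) \<times> (real^'n) \<Rightarrow> real) \<Rightarrow> (real^'n) \<times> (real^'n) \<Rightarrow> real" where
  "hamiltonian \<Phi> \<rho> = (\<lambda>(q, p). 1 / 2 * (p \<bullet> (matrix_inv (density_covariance \<rho>) *v p)) + \<Phi> q)"

end

theory Submission
  imports Defs
begin

text \<open>
  Under \<open>q = A v + b\<close>, \<open>p = A u\<close> every covariance transforms as \<open>C\<^sub>q = A C\<^sub>v A\<^sup>T\<close>, its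
  generalized square root as \<open>S\<^sub>q = A S\<^sub>v\<close>, and the gradient of the transformed potential at
  \<open>v\<close> is \<open>A\<^sup>T D\<Phi>(A v + b)\<close>. Hence drift and diffusion of \<open>(q, p)\<close> are \<open>A\<close> times those of
  \<open>(v, u)\<close>, and the Ito integral commutes with multiplication by a constant matrix. In the
  Fokker--Planck equation the flux becomes \<open>|det A|\<^sup>2\<close> times its conjugate by the block-diagonal
  map \<open>A \<oplus> A\<close>, and the divergence, a trace of a Jacobian, does not see the conjugation. In each
  case only one implication is computed; the other is the same statement for the inverse affine map.
\<close>

section \<open>Gradients under affine maps\<close>

text \<open>Both formulations live on one probability space and are driven by the same Brownian
  motion: \<open>A\<close> multiplies the square root from the left, so the noise itself is never
  rotated. The main obstacle is that the basic notions are total functions or existence statements.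
  \<open>gradient\<close>, Bochner integrals and \<open>measure\<close> return meaningless values
  outside their domain, so differentiability, finite second moments and measurability accompany the
  identities, and the mean-field laws are controlled only at times in \<open>{0..T}\<close>. The Ito
  integral is given by the existence of approximating simple integrands, so its linearity is proved
  on those approximations, with thresholds rescaled by a norm bound for multiplication by
  \<open>A\<close>. In the Fokker-Planck part the flux has only blockwise derivatives; this suffices
  because the change of variables treats positions and momenta separately. The same separation
  produces the square in \<open>|det A|^2\<close>: one Jacobian factor per block.\<close>

lemma GDERIV_gradient:
  fixes f :: "'a::euclidean_space \<Rightarrow> real"
  assumes "f differentiable at x"
  shows "GDERIV f x :> gradient f x"
proof -
  obtain f' where f': "(f has_derivative f') (at x)"
    using assms by (auto simp: differentiable_def)
  interpret f': bounded_linear f' using f' by (rule has_derivative_bounded_linear)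
  \<comment> \<open>The Riesz representative of the derivative, read off from its values on the
    orthonormal basis.\<close>
  have "f' h = h \<bullet> (\<Sum>b\<in>Basis. f' b *\<^sub>R b)" for h
  proof -
    have "f' h = f' (\<Sum>b\<in>Basis. (h \<bullet> b) *\<^sub>R b)"
      by (simp add: euclidean_representation)
    then show ?thesis
      by (simp add: f'.sum f'.scaleR inner_sum_right mult.commute)
  qed
  then have "f' = (\<lambda>h. h \<bullet> (\<Sum>b\<in>Basis. f' b *\<^sub>R b))" ..
  with f' have *: "GDERIV f x :> (\<Sum>b\<in>Basis. f' b *\<^sub>R b)"
    unfolding gderiv_def by simp
  \<comment> \<open>\<open>gradient\<close> is a definite description, so existence alone does not
    determine its value.\<close>
  have "D = (\<Sum>b\<in>Basis. f' b *\<^sub>R b)" if "GDERIV f x :> D" for D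
  proof -
    have "(\<lambda>h. h \<bullet> D) = (\<lambda>h. h \<bullet> (\<Sum>b\<in>Basis. f' b *\<^sub>R b))"
      using that * has_derivative_unique unfolding gderiv_def by blast
    then show ?thesis using vector_eq_ldot[THEN iffD1] by (simp add: fun_eq_iff)
  qed
  with * show ?thesis unfolding gradient_def by (rule theI)
qed

lemma gradient_eqI:
  fixes f :: "'a::euclidean_space \<Rightarrow> real"
  assumes "GDERIV f x :> D"
  shows "gradient f x = D"
proof -
  have "f differentiable at x"
    using assms by (auto simp: gderiv_def differentiable_def)
  from GDERIV_gradient[OF this] assms have "(\<lambda>h. h \<bullet> gradient f x) = (\<lambda>h. h \<bullet> D)"
    unfolding gderiv_def by (rule has_derivative_unique)
  then show ?thesis using vector_eq_ldot[THEN iffD1] by (simp add: fun_eq_iff)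
qed

text \<open>Chain rule, with the derivative then moved across the inner product. The adjoint
  \<open>L'\<close> is a parameter because two cases occur: \<open>transpose A\<close> on positions
  and its block-diagonal double on phase space.\<close>

lemma gradient_compose:
  fixes f :: "'a::euclidean_space \<Rightarrow> real" and g :: "'b::euclidean_space \<Rightarrow> 'a"
  assumes f: "f differentiable at (g x)" and g: "(g has_derivative L) (at x)"
    and adj: "\<And>h y. L h \<bullet> y = h \<bullet> L' y"
  shows "gradient (\<lambda>x. f (g x)) x = L' (gradient f (g x))"
proof (rule gradient_eqI)
  have "((\<lambda>x. f (g x)) has_derivative (\<lambda>h. L h \<bullet> gradient f (g x))) (at x)"
    using GDERIV_gradient[OF f] unfolding gderiv_def
    by (rule has_derivative_compose[OF g])
  then show "GDERIV (\<lambda>x. f (g x)) x :> L' (gradient f (g x))"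
    by (simp add: gderiv_def adj)
qed

lemma has_derivative_affine:
  fixes A :: "real^'n^'m"
  shows "((\<lambda>x. A *v x + b) has_derivative (*v) A) (at x within S)"
proof -
  have "((\<lambda>x. A *v x + b) has_derivative (\<lambda>h. A *v h + 0)) (at x within S)"
    by (intro has_derivative_add has_derivative_const bounded_linear_imp_has_derivative
        matrix_vector_mul_bounded_linear)
  then show ?thesis by simp
qed

lemma inner_matrix_transpose:
  fixes A :: "real^'n^'m"
  shows "(A *v h) \<bullet> y = h \<bullet> (transpose A *v y)"
  by (metis dot_lmul_matrix vector_transpose_matrix)

lemma gradient_affine:
  fixes \<Phi> :: "real^'m \<Rightarrow> real" and A :: "real^'n^'m"
  assumes "\<Phi> differentiable at (A *v x + b)"
  shows "gradient (\<lambda>x. \<Phi> (A *v x + b)) x = transpose A *v gradient \<Phi> (A *v x + b)"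
  using assms has_derivative_affine inner_matrix_transpose by (rule gradient_compose)

section \<open>Inverse matrices, and continuity of matrix products\<close>

lemma matrix_inv_cancel:
  fixes A :: "real^'n^'n"
  assumes "invertible A"
  shows "A ** matrix_inv A = mat 1" "matrix_inv A ** A = mat 1"
    "A ** (matrix_inv A ** B) = B" "matrix_inv A ** (A ** B) = B"
    "A *v (matrix_inv A *v x) = x" "matrix_inv A *v (A *v x) = x"
proof -
  show *: "A ** matrix_inv A = mat 1" "matrix_inv A ** A = mat 1"
    using someI_ex[OF assms[unfolded invertible_def]] by (simp_all add: matrix_inv_def)
  show "A ** (matrix_inv A ** B) = B" "matrix_inv A ** (A ** B) = B"
    "A *v (matrix_inv A *v x) = x" "matrix_inv A *v (A *v x) = x"
    by (simp_all add: * matrix_mul_assoc matrix_vector_mul_assoc)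
qed

text \<open>Later supplies everything used about \<open>A ** X\<close>: measurability, boundedness
  of images, linearity over sums and scalars, and the norm constant \<open>K\<close>.\<close>

lemma bounded_linear_matrix_matrix_mult:
  fixes A :: "real^'k^'n"
  shows "bounded_linear (\<lambda>X :: real^'m^'k. A ** X)"
  unfolding linear_conv_bounded_linear[symmetric]
  by (rule linearI) (simp_all add: vec_eq_iff matrix_matrix_mult_def sum_distrib_left
     sum.distrib distrib_left ac_simps)

lemma borel_measurable_matrix_vector [measurable (raw)]:
  fixes A :: "real^'k^'n"
  assumes "f \<in> borel_measurable M"
  shows "(\<lambda>x. A *v f x) \<in> borel_measurable M"
  by (rule measurable_compose[OF assms borel_measurable_continuous_onI])
    (intro linear_continuous_on matrix_vector_mul_bounded_linear)

lemma borel_measurable_matrix_matrix [measurable (raw)]: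
  fixes A :: "real^'k^'n" and f :: "'a \<Rightarrow> real^'m^'k"
  assumes "f \<in> borel_measurable M"
  shows "(\<lambda>x. A ** f x) \<in> borel_measurable M"
  by (rule measurable_compose[OF assms borel_measurable_continuous_onI])
    (intro linear_continuous_on bounded_linear_matrix_matrix_mult)

section \<open>Linear images of Ito integrals\<close>

lemma simple_integrand_linear:
  assumes "simple_integrand M F m \<tau> \<xi>"
  shows "simple_integrand M F m \<tau> (\<lambda>k \<omega>. A ** \<xi> k \<omega>)"
proof -
  have "bounded ((\<lambda>\<omega>. A ** \<xi> k \<omega>) ` space M)" if "k < m" for k
    using bounded_linear_image[OF _ bounded_linear_matrix_matrix_mult, of "\<xi> k ` space M" A] that assms
    by (simp add: simple_integrand_def image_image)
  then show ?thesis using assms by (simp add: simple_integrand_def borel_measurable_matrix_matrix)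
qed

lemma step_process_linear:
  "step_process m \<tau> (\<lambda>k \<omega>. A ** \<xi> k \<omega>) s \<omega> = A ** step_process m \<tau> \<xi> s \<omega>"
  unfolding step_process_def
  by (simp add: bounded_linear.linear[OF bounded_linear_matrix_matrix_mult, THEN linear_sum]
     bounded_linear.linear[OF bounded_linear_matrix_matrix_mult, THEN linear_scale])

lemma step_integral_linear:
  "step_integral W m \<tau> (\<lambda>k \<omega>. A ** \<xi> k \<omega>) t \<omega> = A *v step_integral W m \<tau> \<xi> t \<omega>"
  unfolding step_integral_def
  by (simp add: matrix_vector_mul_assoc[symmetric] linear_sum[OF matrix_vector_mul_linear])

text \<open>Integrating out time in \<open>borel_measurable_L2_distance\<close> requires joint
  measurability with time as the second component; measurability at each fixed time would not
  do.\<close>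

lemma borel_measurable_step_process:
  assumes "\<And>k. subalgebra M (F k)" and "simple_integrand M F m \<tau> \<xi>"
  shows "(\<lambda>(\<omega>, s). step_process m \<tau> \<xi> s \<omega>) \<in> borel_measurable (M \<Otimes>\<^sub>M borel)"
proof -
  have [measurable]: "\<xi> k \<in> borel_measurable M" if "k < m" for k
    using assms that measurable_from_subalg[of M "F (\<tau> k)" "\<xi> k" borel] unfolding simple_integrand_def by blast
  show ?thesis unfolding step_process_def split_beta
    by measurable
qed

text \<open>Both factors are random here, so the product is treated as a continuous function of the
  pair.\<close>

lemma borel_measurable_matrix_vector_mult:
  fixes X :: "'a \<Rightarrow> real^'k^'n"
  assumes "X \<in> borel_measurable M" and "Y \<in> borel_measurable M"
  shows "(\<lambda>\<omega>. X \<omega> *v Y \<omega>) \<in> borel_measurable M"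
proof -
  have "continuous_on UNIV (\<lambda>Z :: (real^'k^'n) \<times> (real^'k). fst Z *v snd Z)"
    unfolding matrix_vector_mult_def by (intro continuous_intros)
  then have cont: "(\<lambda>Z :: (real^'k^'n) \<times> (real^'k). fst Z *v snd Z) \<in> borel_measurable borel"
    by (rule borel_measurable_continuous_onI)
  have "(\<lambda>\<omega>. (X \<omega>, Y \<omega>)) \<in> borel_measurable M"
    using assms by (rule borel_measurable_Pair)
  from measurable_compose[OF this cont] show ?thesis by simp
qed

lemma borel_measurable_step_integral:
  assumes "\<And>k. subalgebra M (F k)" and "simple_integrand M F m \<tau> \<xi>"
    and W: "\<And>s. s \<ge> 0 \<Longrightarrow> W s \<in> borel_measurable (F s)" and "t \<ge> 0"
  shows "step_integral W m \<tau> \<xi> t \<in> borel_measurable M"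
proof -
  have [simp]: "\<xi> k \<in> borel_measurable M" if "k < m" for k
    using assms that measurable_from_subalg[of M "F (\<tau> k)" "\<xi> k" borel] unfolding simple_integrand_def by blast
  \<comment> \<open>\<open>W\<close> is known to be adapted only at nonnegative times; the grid
    starts at \<open>\<tau> 0 \<ge> 0\<close> and increases.\<close>
  have "\<tau> k \<ge> 0" for k
    using assms(2) incseqD[of \<tau> 0 k] unfolding simple_integrand_def by (meson le0 order_trans)
  then have [simp]: "W (min (\<tau> k) t) \<in> borel_measurable M" for k
    using measurable_from_subalg[OF assms(1) W] \<open>t \<ge> 0\<close> by simp
  show ?thesis unfolding step_integral_def
    by (intro borel_measurable_sum borel_measurable_matrix_vector_mult borel_measurable_diff) simp_all
qed

text \<open>The identity is measurable from \<open>M\<close> to the smaller sigma-algebra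
  \<open>N\<close>, so progressive measurability passes to \<open>M\<close> after swapping the two
  factors.\<close>

lemma borel_measurable_integrand:
  fixes t :: real
  assumes sub: "subalgebra M N" and
    H: "(\<lambda>(s, \<omega>). H s \<omega>) \<in> borel_measurable (restrict_space borel {0..t} \<Otimes>\<^sub>M N)"
  shows "(\<lambda>(\<omega>, s). H s \<omega>) \<in> borel_measurable (M \<Otimes>\<^sub>M restrict_space borel {0..t})"
proof -
  have id: "(\<lambda>x. x) \<in> M \<rightarrow>\<^sub>M N"
    using sub by (rule measurable_from_subalg) simp
  have "(\<lambda>x. (snd x, fst x)) \<in> M \<Otimes>\<^sub>M restrict_space borel {0..t} \<rightarrow>\<^sub>M restrict_space borel {0..t} \<Otimes>\<^sub>M N"
    by (intro measurable_Pair measurable_snd measurable_compose[OF measurable_fst id])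
  from measurable_compose[OF this H] show ?thesis by (simp add: split_beta)
qed

text \<open>Needed because \<^const>\<open>measure\<close> of a non-measurable set is 0: without it, the events in the
  definition of the Ito integral could not be compared by monotonicity.\<close>

lemma borel_measurable_L2_distance:
  assumes sub: "\<And>s. subalgebra M (F s)" and xi: "simple_integrand M F m \<tau> \<xi>"
    and H: "(\<lambda>(s, \<omega>). H s \<omega>) \<in> borel_measurable (restrict_space borel {0..t} \<Otimes>\<^sub>M F t)"
  shows "(\<lambda>\<omega>. \<integral>\<^sup>+ s\<in>{0..t}. ennreal ((norm (step_process m \<tau> \<xi> s \<omega> - H s \<omega>))\<^sup>2) \<partial>lborel)
    \<in> borel_measurable M"
proof -
  have b: "sets (restrict_space lborel {0..t}) = sets (restrict_space borel {0..t})"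
    by (simp add: sets_restrict_space)
  have [measurable]: "(\<lambda>(\<omega>, s). H s \<omega>) \<in> borel_measurable (M \<Otimes>\<^sub>M restrict_space lborel {0..t})"
    using borel_measurable_integrand[OF sub H]
    unfolding measurable_cong_sets[OF sets_pair_measure_cong[OF refl b] refl] .
  have i: "(\<lambda>x. x) \<in> restrict_space lborel {0..t} \<rightarrow>\<^sub>M borel"
    by (rule measurable_restrict_space1) simp
  have "(\<lambda>x. (fst x, snd x)) \<in> M \<Otimes>\<^sub>M restrict_space lborel {0..t} \<rightarrow>\<^sub>M M \<Otimes>\<^sub>M borel"
    by (intro measurable_Pair measurable_fst measurable_compose[OF measurable_snd i])
  from measurable_compose[OF this borel_measurable_step_process[OF sub xi]]
  have [measurable]: "(\<lambda>(\<omega>, s). step_process m \<tau> \<xi> s \<omega>) \<in> borel_measurable (M \<Otimes>\<^sub>M restrict_space lborel {0..t})"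
    by (simp add: split_beta)
  \<comment> \<open>Sigma-finiteness of the time measure is what makes the integral over
    \<open>s\<close> measurable in \<open>\<omega>\<close>.\<close>
  interpret sigma_finite_measure "restrict_space lborel {0..t}"
    by (rule sigma_finite_measure_restrict_space) (auto intro: lborel.sigma_finite_measure_axioms)
  have "(\<lambda>\<omega>. \<integral>\<^sup>+ s. ennreal ((norm (step_process m \<tau> \<xi> s \<omega> - H s \<omega>))\<^sup>2) \<partial>restrict_space lborel {0..t})
    \<in> borel_measurable M"
    by measurable
  then show ?thesis by (simp add: nn_integral_restrict_space)
qed

text \<open>The witnesses are the simple integrands of \<open>H\<close> multiplied by
  \<open>A\<close>. Both errors grow at most by the factor \<open>K\<^sup>2\<close> or
  \<open>K\<close> of a norm bound, so each new event at threshold \<open>\<epsilon>\<close> lies in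
  the old event at \<open>\<epsilon> / K\<^sup>2\<close> or \<open>\<epsilon> / K\<close>, whose
  probability tends to 0.\<close>

lemma has_ito_integral_linear:
  fixes A :: "real^'k^'n" and H :: "real \<Rightarrow> 'w \<Rightarrow> real^'m^'k"
  assumes "prob_space M" and sub: "\<And>s. subalgebra M (F s)"
    and W: "\<And>s. s \<ge> 0 \<Longrightarrow> W s \<in> borel_measurable (F s)" and t: "t \<ge> 0"
    and ito: "has_ito_integral M F W t H X"
  shows "has_ito_integral M F W t (\<lambda>s \<omega>. A ** H s \<omega>) (\<lambda>\<omega>. A *v X \<omega>)"
proof -
  interpret prob_space M by fact
  from ito obtain m \<tau> \<xi> where
    prog: "\<forall>r\<in>{0..t}. (\<lambda>(s, \<omega>). H s \<omega>) \<in> borel_measurable (restrict_space borel {0..r} \<Otimes>\<^sub>M F r)"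
    and X[measurable]: "X \<in> borel_measurable M"
    and xi: "\<And>j. simple_integrand M F (m j) (\<tau> j) (\<xi> j)"
    and L2: "\<And>\<epsilon>. \<epsilon> > 0 \<Longrightarrow> (\<lambda>j::nat. measure M {\<omega> \<in> space M. ennreal \<epsilon> <
            (\<integral>\<^sup>+ s\<in>{0..t}. ennreal ((norm (step_process (m j) (\<tau> j) (\<xi> j) s \<omega> - H s \<omega>))\<^sup>2) \<partial>lborel)})
          \<longlonglongrightarrow> 0"
    and pr: "\<And>\<epsilon>. \<epsilon> > 0 \<Longrightarrow> (\<lambda>j. measure M {\<omega> \<in> space M. \<epsilon> <
            norm (step_integral W (m j) (\<tau> j) (\<xi> j) t \<omega> - X \<omega>)}) \<longlonglongrightarrow> 0"
    unfolding has_ito_integral_def by blast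
  have [measurable]: "step_integral W (m j) (\<tau> j) (\<xi> j) t \<in> borel_measurable M" for j
    using sub xi W t by (rule borel_measurable_step_integral)
  have [measurable]: "(\<lambda>\<omega>. \<integral>\<^sup>+ s\<in>{0..t}. ennreal ((norm (step_process (m j) (\<tau> j) (\<xi> j) s \<omega> - H s \<omega>))\<^sup>2) \<partial>lborel)
    \<in> borel_measurable M" for j
    using sub xi prog t by (intro borel_measurable_L2_distance) auto
  \<comment> \<open>Sandwich between 0 and the old probabilities. The measurability obligation falls
    on the larger, old event, and the two preceding facts discharge it.\<close>
  have meas_conv: "(\<lambda>j. measure M (E' j)) \<longlonglongrightarrow> 0"
    if "(\<lambda>j. measure M (E j)) \<longlonglongrightarrow> 0" "\<And>j. E j \<in> sets M" "\<And>j. E' j \<subseteq> E j" for E E' :: "nat \<Rightarrow> 'w set"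
    by (rule tendsto_sandwich[OF _ _ tendsto_const that(1)])
       (auto intro!: always_eventually finite_measure_mono that(2,3))
  show ?thesis
    unfolding has_ito_integral_def
  proof (intro conjI exI allI impI ballI)
    fix r assume "r \<in> {0..t}"
    with prog have "(\<lambda>(s, \<omega>). H s \<omega>) \<in> borel_measurable (restrict_space borel {0..r} \<Otimes>\<^sub>M F r)" by blast
    then show "(\<lambda>(s, \<omega>). A ** H s \<omega>) \<in> borel_measurable (restrict_space borel {0..r} \<Otimes>\<^sub>M F r)"
      unfolding split_beta by (rule borel_measurable_matrix_matrix)
  next
    show "(\<lambda>\<omega>. A *v X \<omega>) \<in> borel_measurable M" by measurable
  next
    show "simple_integrand M F (m j) (\<tau> j) (\<lambda>k \<omega>. A ** \<xi> j k \<omega>)" for j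
      using xi by (rule simple_integrand_linear)
  next
    fix \<epsilon> :: real assume "\<epsilon> > 0"
    obtain K where K: "K > 0" "\<And>Y::real^'m^'k. norm (A ** Y) \<le> norm Y * K"
      using bounded_linear.pos_bounded[OF bounded_linear_matrix_matrix_mult] by blast
    let ?d = "\<lambda>j s \<omega>. step_process (m j) (\<tau> j) (\<xi> j) s \<omega> - H s \<omega>"
    show "(\<lambda>j. measure M {\<omega> \<in> space M. ennreal \<epsilon> <
            (\<integral>\<^sup>+ s\<in>{0..t}. ennreal ((norm (step_process (m j) (\<tau> j) (\<lambda>k \<omega>. A ** \<xi> j k \<omega>) s \<omega> - A ** H s \<omega>))\<^sup>2) \<partial>lborel)})
          \<longlonglongrightarrow> 0"
    proof (rule meas_conv[OF L2[of "\<epsilon> / K\<^sup>2"]])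
      fix j
      show "{\<omega> \<in> space M. ennreal \<epsilon> <
            (\<integral>\<^sup>+ s\<in>{0..t}. ennreal ((norm (step_process (m j) (\<tau> j) (\<lambda>k \<omega>. A ** \<xi> j k \<omega>) s \<omega> - A ** H s \<omega>))\<^sup>2) \<partial>lborel)}
        \<subseteq> {\<omega> \<in> space M. ennreal (\<epsilon> / K\<^sup>2) < (\<integral>\<^sup>+ s\<in>{0..t}. ennreal ((norm (?d j s \<omega>))\<^sup>2) \<partial>lborel)}"
      proof safe
        fix \<omega> assume w: "\<omega> \<in> space M" and less: "ennreal \<epsilon> <
            (\<integral>\<^sup>+ s\<in>{0..t}. ennreal ((norm (step_process (m j) (\<tau> j) (\<lambda>k \<omega>. A ** \<xi> j k \<omega>) s \<omega> - A ** H s \<omega>))\<^sup>2) \<partial>lborel)"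
        \<comment> \<open>Measurability of the section at fixed \<open>\<omega>\<close>, required
          for pulling the constant \<open>K\<^sup>2\<close> out of the integral.\<close>
        have ms: "(\<lambda>s. ennreal ((norm (?d j s \<omega>))\<^sup>2) * indicator {0..t} s) \<in> borel_measurable lborel"
        proof -
          have "(\<lambda>(\<omega>, s). H s \<omega>) \<in> borel_measurable (M \<Otimes>\<^sub>M restrict_space borel {0..t})"
            using prog t by (intro borel_measurable_integrand[OF sub]) auto
          from measurable_compose[OF measurable_Pair1'[OF w] this]
          have "(\<lambda>s. H s \<omega>) \<in> borel_measurable (restrict_space borel {0..t})" by simp
          moreover have "(\<lambda>s. step_process (m j) (\<tau> j) (\<xi> j) s \<omega>) \<in> borel_measurable (restrict_space borel {0..t})"
            unfolding step_process_def by (rule measurable_restrict_space1) measurable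
          ultimately have "(\<lambda>s. ennreal ((norm (?d j s \<omega>))\<^sup>2)) \<in> borel_measurable (restrict_space borel {0..t})"
            by measurable
          then show ?thesis
            by (subst (asm) borel_measurable_restrict_space_iff_ennreal) auto
        qed
        have "ennreal \<epsilon> < (\<integral>\<^sup>+ s\<in>{0..t}. ennreal ((norm (A ** ?d j s \<omega>))\<^sup>2) \<partial>lborel)"
          using less by (simp add: step_process_linear bounded_linear.linear[OF bounded_linear_matrix_matrix_mult, THEN linear_diff])
        also have "\<dots> \<le> (\<integral>\<^sup>+ s. ennreal (K\<^sup>2) * (ennreal ((norm (?d j s \<omega>))\<^sup>2) * indicator {0..t} s) \<partial>lborel)"
        proof (rule nn_integral_mono)
          fix s
          have "(norm (A ** ?d j s \<omega>))\<^sup>2 \<le> (norm (?d j s \<omega>) * K)\<^sup>2"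
            by (intro power_mono K) simp
          then show "ennreal ((norm (A ** ?d j s \<omega>))\<^sup>2) * indicator {0..t} s
              \<le> ennreal (K\<^sup>2) * (ennreal ((norm (?d j s \<omega>))\<^sup>2) * indicator {0..t} s)"
            by (auto simp: indicator_def ennreal_mult[symmetric] power_mult_distrib mult.commute intro!: ennreal_leI)
        qed
        also have "\<dots> = ennreal (K\<^sup>2) * (\<integral>\<^sup>+ s\<in>{0..t}. ennreal ((norm (?d j s \<omega>))\<^sup>2) \<partial>lborel)"
          using ms by (rule nn_integral_cmult)
        finally have *: "ennreal \<epsilon> < ennreal (K\<^sup>2) * (\<integral>\<^sup>+ s\<in>{0..t}. ennreal ((norm (?d j s \<omega>))\<^sup>2) \<partial>lborel)" .
        show "ennreal (\<epsilon> / K\<^sup>2) < (\<integral>\<^sup>+ s\<in>{0..t}. ennreal ((norm (?d j s \<omega>))\<^sup>2) \<partial>lborel)"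
        \<comment> \<open>The negated inequality is multiplied by \<open>K\<^sup>2\<close>, which
          avoids dividing in \<open>ennreal\<close>.\<close>
        proof (rule ccontr)
          assume "\<not> ?thesis"
          then have "ennreal (K\<^sup>2) * (\<integral>\<^sup>+ s\<in>{0..t}. ennreal ((norm (?d j s \<omega>))\<^sup>2) \<partial>lborel) \<le> ennreal (K\<^sup>2) * ennreal (\<epsilon> / K\<^sup>2)"
            by (intro mult_left_mono) auto
          also have "\<dots> = ennreal \<epsilon>"
            using K \<open>\<epsilon> > 0\<close> by (simp add: ennreal_mult[symmetric])
          finally show False using * by simp
        qed
      qed
    qed (use \<open>\<epsilon> > 0\<close> K in auto)
  next
    fix \<epsilon> :: real assume "\<epsilon> > 0"
    obtain K where K: "K > 0" "\<And>x. norm (A *v x) \<le> norm x * K"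
      using bounded_linear.pos_bounded[OF matrix_vector_mul_bounded_linear] by blast
    let ?d = "\<lambda>j \<omega>. step_integral W (m j) (\<tau> j) (\<xi> j) t \<omega> - X \<omega>"
    show "(\<lambda>j. measure M {\<omega> \<in> space M. \<epsilon> <
            norm (step_integral W (m j) (\<tau> j) (\<lambda>k \<omega>. A ** \<xi> j k \<omega>) t \<omega> - A *v X \<omega>)}) \<longlonglongrightarrow> 0"
    proof (rule meas_conv[OF pr[of "\<epsilon> / K"]])
      fix j
      have "\<epsilon> / K < norm (?d j \<omega>)" if "\<epsilon> < norm (A *v ?d j \<omega>)" for \<omega>
        using less_le_trans[OF that K(2)] K(1) by (simp add: field_simps)
      then show "{\<omega> \<in> space M. \<epsilon> < norm (step_integral W (m j) (\<tau> j) (\<lambda>k \<omega>. A ** \<xi> j k \<omega>) t \<omega> - A *v X \<omega>)}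
        \<subseteq> {\<omega> \<in> space M. \<epsilon> / K < norm (?d j \<omega>)}"
        by (auto simp: step_integral_linear matrix_vector_mult_diff_distrib)
    qed (use \<open>\<epsilon> > 0\<close> K in auto)
  qed
qed

text \<open>The definition inspects the integrand only at times in \<open>{0..t}\<close>. This lets
  \<open>second_order_sde_affine\<close> ask for agreement of the coefficients only on the time
  interval of the equation.\<close>

lemma has_ito_integral_cong:
  assumes "\<And>s \<omega>. s \<in> {0..t} \<Longrightarrow> H s \<omega> = H' s \<omega>"
    and "has_ito_integral M F W t H X"
  shows "has_ito_integral M F W t H' X"
proof -
  have 1: "(\<lambda>(s, \<omega>). H' s \<omega>) \<in> borel_measurable (restrict_space borel {0..r} \<Otimes>\<^sub>M F r)"
    if "(\<lambda>(s, \<omega>). H s \<omega>) \<in> borel_measurable (restrict_space borel {0..r} \<Otimes>\<^sub>M F r)" "r \<in> {0..t}" for r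
  proof -
    have "(case x of (s, \<omega>) \<Rightarrow> H s \<omega>) = (case x of (s, \<omega>) \<Rightarrow> H' s \<omega>)"
      if "x \<in> space (restrict_space borel {0..r} \<Otimes>\<^sub>M F r)" for x
      using that \<open>r \<in> {0..t}\<close> assms(1)
      by (cases x) (simp add: space_pair_measure space_restrict_space)
    from measurable_cong[where f = "\<lambda>(s, \<omega>). H s \<omega>" and g = "\<lambda>(s, \<omega>). H' s \<omega>", OF this] that(1)
    show ?thesis by blast
  qed
  have "(\<integral>\<^sup>+ s\<in>{0..t}. ennreal ((norm (f s \<omega> - H' s \<omega>))\<^sup>2) \<partial>lborel)
      = (\<integral>\<^sup>+ s\<in>{0..t}. ennreal ((norm (f s \<omega> - H s \<omega>))\<^sup>2) \<partial>lborel)" for f \<omega>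
    by (intro nn_integral_cong) (auto simp: assms(1) indicator_def)
  with assms(2) 1 show ?thesis unfolding has_ito_integral_def by simp
qed

text \<open>The shift \<open>b\<close> disappears on differentiating the position; the bounded
  linear map \<open>A\<close> commutes with the time derivative and with the Lebesgue and Ito
  integrals. The coefficient identities are asked only on \<open>{0..T}\<close>, because the
  mean-field covariance is controlled only there.\<close>

lemma second_order_sde_affine:
  fixes A :: "real^'k^'n" and \<sigma> :: "real \<Rightarrow> 'w \<Rightarrow> real^'m^'k"
  assumes "filtered_prob_space M F" and "standard_brownian_motion M F W"
    and sde: "second_order_sde M F W T f \<sigma> q p"
    and f': "\<And>t \<omega>. t \<in> {0..T} \<Longrightarrow> f' t \<omega> = A *v f t \<omega>"
    and \<sigma>': "\<And>t \<omega>. t \<in> {0..T} \<Longrightarrow> \<sigma>' t \<omega> = A ** \<sigma> t \<omega>"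
  shows "second_order_sde M F W T f' \<sigma>' (\<lambda>t \<omega>. A *v q t \<omega> + b) (\<lambda>t \<omega>. A *v p t \<omega>)"
proof -
  have A: "bounded_linear ((*v) A)" by simp
  have M: "prob_space M" and sub: "\<And>s. subalgebra M (F s)"
    using assms(1) by (auto simp: filtered_prob_space_def)
  have W: "\<And>s. s \<ge> 0 \<Longrightarrow> W s \<in> borel_measurable (F s)"
    using assms(2) by (auto simp: standard_brownian_motion_def)
  obtain Y where
    meas: "\<And>t. t \<in> {0..T} \<Longrightarrow> q t \<in> borel_measurable (F t) \<and> p t \<in> borel_measurable (F t)"
    and cont: "AE \<omega> in M. continuous_on {0..T} (\<lambda>t. p t \<omega>)"
    and deriv: "AE \<omega> in M. \<forall>t\<in>{0..T}. ((\<lambda>s. q s \<omega>) has_vector_derivative p t \<omega>) (at t within {0..T})"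
    and Y: "\<And>t. t \<in> {0..T} \<Longrightarrow> has_ito_integral M F W t \<sigma> (Y t)"
    and eq: "AE \<omega> in M. \<forall>t\<in>{0..T}. set_integrable lborel {0..t} (\<lambda>s. f s \<omega>) \<and>
           p t \<omega> = p 0 \<omega> + (LINT s:{0..t}|lborel. f s \<omega>) + Y t \<omega>"
    using sde unfolding second_order_sde_def by blast
  show ?thesis
    unfolding second_order_sde_def
  proof (intro conjI ballI exI[of _ "\<lambda>t \<omega>. A *v Y t \<omega>"])
    fix t assume "t \<in> {0..T}"
    with meas show "(\<lambda>\<omega>. A *v q t \<omega> + b) \<in> borel_measurable (F t)" "(\<lambda>\<omega>. A *v p t \<omega>) \<in> borel_measurable (F t)"
      by (auto intro!: borel_measurable_add borel_measurable_matrix_vector)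
  next
    show "AE \<omega> in M. continuous_on {0..T} (\<lambda>t. A *v p t \<omega>)"
      using cont by eventually_elim (rule bounded_linear.continuous_on[OF A])
    show "AE \<omega> in M. \<forall>t\<in>{0..T}. ((\<lambda>s. A *v q s \<omega> + b) has_vector_derivative A *v p t \<omega>) (at t within {0..T})"
      using deriv
    proof (eventually_elim, intro ballI)
      fix \<omega> t assume "t \<in> {0..T}"
        "\<forall>t\<in>{0..T}. ((\<lambda>s. q s \<omega>) has_vector_derivative p t \<omega>) (at t within {0..T})"
      then have "((\<lambda>s. A *v q s \<omega>) has_vector_derivative A *v p t \<omega>) (at t within {0..T})"
        using bounded_linear.has_vector_derivative[OF A] by blast
      from has_vector_derivative_add[OF this has_vector_derivative_const[of b]]
      show "((\<lambda>s. A *v q s \<omega> + b) has_vector_derivative A *v p t \<omega>) (at t within {0..T})" by simp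
    qed
  next
    fix t assume t: "t \<in> {0..T}"
    then have "has_ito_integral M F W t (\<lambda>s \<omega>. A ** \<sigma> s \<omega>) (\<lambda>\<omega>. A *v Y t \<omega>)"
      using has_ito_integral_linear[OF M sub W _ Y[OF t]] by simp
    then show "has_ito_integral M F W t \<sigma>' (\<lambda>\<omega>. A *v Y t \<omega>)"
      by (rule has_ito_integral_cong[rotated]) (use \<sigma>' t in auto)
  next
    show "AE \<omega> in M. \<forall>t\<in>{0..T}. set_integrable lborel {0..t} (\<lambda>s. f' s \<omega>) \<and>
           A *v p t \<omega> = A *v p 0 \<omega> + (LINT s:{0..t}|lborel. f' s \<omega>) + A *v Y t \<omega>"
      using eq
    proof (rule eventually_mono, intro ballI)
      fix \<omega> t assume t: "t \<in> {0..T}" and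
        "\<forall>t\<in>{0..T}. set_integrable lborel {0..t} (\<lambda>s. f s \<omega>) \<and>
           p t \<omega> = p 0 \<omega> + (LINT s:{0..t}|lborel. f s \<omega>) + Y t \<omega>"
      then have int: "set_integrable lborel {0..t} (\<lambda>s. f s \<omega>)" and
        pt: "p t \<omega> = p 0 \<omega> + (LINT s:{0..t}|lborel. f s \<omega>) + Y t \<omega>" by blast+
      have f'_eq: "indicator {0..t} s *\<^sub>R f' s \<omega> = A *v (indicator {0..t} s *\<^sub>R f s \<omega>)" for s
        using t f' by (auto simp: indicator_def)
      have "(LINT s:{0..t}|lborel. f' s \<omega>) = A *v (LINT s:{0..t}|lborel. f s \<omega>)"
        using integral_bounded_linear[OF A int[unfolded set_integrable_def]]
        by (simp add: set_lebesgue_integral_def f'_eq)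
      moreover have "set_integrable lborel {0..t} (\<lambda>s. f' s \<omega>)"
        using integrable_bounded_linear[OF A int[unfolded set_integrable_def]]
        by (simp add: set_integrable_def f'_eq)
      ultimately show "set_integrable lborel {0..t} (\<lambda>s. f' s \<omega>) \<and>
           A *v p t \<omega> = A *v p 0 \<omega> + (LINT s:{0..t}|lborel. f' s \<omega>) + A *v Y t \<omega>"
        by (simp add: pt matrix_vector_right_distrib)
    qed
  qed
qed

section \<open>Covariance under affine maps\<close>

text \<open>Domination by \<open>(norm x)\<^sup>2\<close> and by
  \<open>1 + (norm x)\<^sup>2\<close>, where the constant is integrable under a probability. Since
  non-integrable functions have Bochner integral 0, linearity of means and covariances rests on
  these facts.\<close>

lemma integrable_coordinates:
  fixes \<mu> :: "(real^'n) measure"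
  assumes "prob_space \<mu>" and sets: "sets \<mu> = sets borel" and "finite_second_moment \<mu>"
  shows "integrable \<mu> (\<lambda>x. x $ i)" and "integrable \<mu> (\<lambda>x. x $ i * x $ j)"
proof -
  interpret prob_space \<mu> by fact
  have sq: "integrable \<mu> (\<lambda>x. (norm x)\<^sup>2)"
    using assms(3) by (simp add: finite_second_moment_def)
  have m: "(\<lambda>x. x $ k) \<in> borel_measurable \<mu>" for k
    unfolding measurable_cong_sets[OF sets refl]
    by (intro borel_measurable_continuous_onI continuous_intros)
  show "integrable \<mu> (\<lambda>x. x $ i * x $ j)"
  proof (rule Bochner_Integration.integrable_bound[OF sq])
    show "(\<lambda>x. x $ i * x $ j) \<in> borel_measurable \<mu>"
      using m by simp
    have "\<bar>x $ i * x $ j\<bar> \<le> (norm x)\<^sup>2" for x :: "real^'n"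
      unfolding abs_mult power2_eq_square by (intro mult_mono component_le_norm_cart) auto
    then show "AE x in \<mu>. norm (x $ i * x $ j) \<le> norm ((norm x)\<^sup>2)" by simp
  qed
  show "integrable \<mu> (\<lambda>x. x $ i)"
  proof (rule Bochner_Integration.integrable_bound)
    show "integrable \<mu> (\<lambda>x. 1 + (norm x)\<^sup>2)"
      using sq by simp
    have "\<bar>x $ i\<bar> \<le> 1 + (norm x)\<^sup>2" for x :: "real^'n"
    proof -
      have "\<bar>x $ i\<bar> \<le> norm x" by (rule component_le_norm_cart)
      moreover have "2 * norm x \<le> 1 + (norm x)\<^sup>2"
        using zero_le_power2[of "norm x - 1"] by (simp add: power2_diff)
      ultimately show ?thesis using norm_ge_zero[of x] by linarith
    qed
    then show "AE x in \<mu>. norm (x $ i) \<le> norm (1 + (norm x)\<^sup>2)" by (simp add: abs_of_nonneg)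
  qed (rule m)
qed

lemma borel_measurable_affine:
  fixes A :: "real^'n^'m"
  shows "(\<lambda>x. A *v x + b) \<in> borel_measurable borel"
  by measurable

text \<open>From (r + s)^2 \<le> 2 r^2 + 2 s^2 with \<open>r = norm x * K\<close> and
  \<open>s = norm b\<close>.\<close>

lemma finite_second_moment_affine:
  fixes \<mu> :: "(real^'n) measure" and A :: "real^'n^'m"
  assumes "prob_space \<mu>" and sets: "sets \<mu> = sets borel" and "finite_second_moment \<mu>"
  shows "finite_second_moment (distr \<mu> borel (\<lambda>x. A *v x + b))"
proof -
  interpret prob_space \<mu> by fact
  have meas: "(\<lambda>x. A *v x + b) \<in> borel_measurable \<mu>"
    using borel_measurable_affine unfolding measurable_cong_sets[OF sets refl] .
  obtain K where K: "K > 0" "\<And>x. norm (A *v x) \<le> norm x * K"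
    using bounded_linear.pos_bounded[OF matrix_vector_mul_bounded_linear] by blast
  have "integrable \<mu> (\<lambda>x. (norm (A *v x + b))\<^sup>2)"
  proof (rule Bochner_Integration.integrable_bound)
    show "integrable \<mu> (\<lambda>x. 2 * K\<^sup>2 * (norm x)\<^sup>2 + 2 * (norm b)\<^sup>2)"
      using assms(3) by (simp add: finite_second_moment_def)
    show "(\<lambda>x. (norm (A *v x + b))\<^sup>2) \<in> borel_measurable \<mu>"
      using meas by simp
    have "(norm (A *v x + b))\<^sup>2 \<le> 2 * K\<^sup>2 * (norm x)\<^sup>2 + 2 * (norm b)\<^sup>2" for x
    proof -
      have "norm (A *v x + b) \<le> norm x * K + norm b"
        using norm_triangle_ineq[of "A *v x" b] K(2)[of x] by linarith
      then have "(norm (A *v x + b))\<^sup>2 \<le> (norm x * K + norm b)\<^sup>2"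
        by (intro power_mono) auto
      also have "\<dots> \<le> 2 * K\<^sup>2 * (norm x)\<^sup>2 + 2 * (norm b)\<^sup>2"
        using zero_le_power2[of "norm x * K - norm b"]
        by (simp add: power2_diff power2_sum power_mult_distrib algebra_simps)
      finally show ?thesis .
    qed
    then show "AE x in \<mu>. norm ((norm (A *v x + b))\<^sup>2) \<le> norm (2 * K\<^sup>2 * (norm x)\<^sup>2 + 2 * (norm b)\<^sup>2)"
      by simp
  qed
  then show ?thesis
    unfolding finite_second_moment_def by (subst integrable_distr_eq[OF meas]) auto
qed

text \<open>Centring cancels \<open>b\<close>, so a centred coordinate of the image is a row of
  \<open>A\<close> applied to the centred \<open>x\<close>. The product of two of them is a finite
  double sum, integrated term by term.\<close>

lemma covariance_affine:
  fixes \<mu> :: "(real^'n) measure" and A :: "real^'n^'m"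
  assumes "prob_space \<mu>" and sets: "sets \<mu> = sets borel" and "finite_second_moment \<mu>"
  shows "covariance (distr \<mu> borel (\<lambda>x. A *v x + b)) = A ** covariance \<mu> ** transpose A"
proof -
  interpret prob_space \<mu> by fact
  note int = integrable_coordinates[OF assms]
  have meas: "(\<lambda>x. A *v x + b) \<in> borel_measurable \<mu>"
    using borel_measurable_affine unfolding measurable_cong_sets[OF sets refl] .
  have coord: "(\<lambda>x :: real^'m. x $ k) \<in> borel_measurable borel" for k
    by (intro borel_measurable_continuous_onI continuous_intros)
  define c where "c k = (\<integral>x. x $ k \<partial>\<mu>)" for k
  have mean: "(\<integral>y. y $ i \<partial>distr \<mu> borel (\<lambda>x. A *v x + b)) = (\<Sum>k\<in>UNIV. A $ i $ k * c k) + b $ i" for i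
    unfolding integral_distr[OF meas coord] by (simp add: matrix_vector_mult_def c_def int prob_space)
  have centred: "(A *v x + b) $ i - ((\<Sum>k\<in>UNIV. A $ i $ k * c k) + b $ i) = (\<Sum>k\<in>UNIV. A $ i $ k * (x $ k - c k))"
    for x i
    by (simp add: matrix_vector_mult_def right_diff_distrib sum_subtractf)
  have int': "integrable \<mu> (\<lambda>x. (x $ k - c k) * (x $ l - c l))" for k l
    using int by (simp add: algebra_simps)
  show ?thesis
  proof (simp add: vec_eq_iff, intro allI)
    fix i j
    have "(\<lambda>y :: real^'m. (y $ i - d) * (y $ j - e)) \<in> borel_measurable borel" for d e
      by (intro borel_measurable_continuous_onI continuous_intros)
    then have "covariance (distr \<mu> borel (\<lambda>x. A *v x + b)) $ i $ j
      = (\<integral>x. (\<Sum>k\<in>UNIV. A $ i $ k * (x $ k - c k)) * (\<Sum>l\<in>UNIV. A $ j $ l * (x $ l - c l)) \<partial>\<mu>)"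
      unfolding covariance_def by (simp only: mean vec_lambda_beta integral_distr[OF meas] centred)
    also have "\<dots> = (\<integral>x. (\<Sum>k\<in>UNIV. \<Sum>l\<in>UNIV. A $ i $ k * A $ j $ l * ((x $ k - c k) * (x $ l - c l))) \<partial>\<mu>)"
      by (intro Bochner_Integration.integral_cong refl) (simp only: sum_product mult.assoc mult.left_commute mult.commute)
    also have "\<dots> = (\<Sum>k\<in>UNIV. \<Sum>l\<in>UNIV. A $ i $ k * A $ j $ l * covariance \<mu> $ k $ l)"
      by (simp add: int' covariance_def c_def[symmetric])
    also have "\<dots> = (A ** covariance \<mu> ** transpose A) $ i $ j"
      unfolding matrix_matrix_mult_def transpose_def
      by (subst sum.swap) (simp add: sum_distrib_left sum_distrib_right ac_simps)
    finally show "covariance (distr \<mu> borel (\<lambda>x. A *v x + b)) $ i $ j = (A ** covariance \<mu> ** transpose A) $ i $ j" .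
  qed
qed

section \<open>Mean-field equation\<close>

text \<open>The trailing \<open>transpose A\<close> of the covariance is absorbed by the chain rule
  for the gradient; the leading \<open>A\<close> stays in front.\<close>

lemma langevin_drift_affine:
  fixes A :: "real^'n^'m" and \<Phi> :: "real^'m \<Rightarrow> real"
  assumes "\<Phi> differentiable at (A *v x + b)"
  shows "langevin_drift \<gamma> \<Phi> (A ** C ** transpose A) (A *v x + b) (A *v p)
    = A *v langevin_drift \<gamma> (\<lambda>x. \<Phi> (A *v x + b)) C x p"
  by (simp add: langevin_drift_def gradient_affine[OF assms] matrix_vector_mult_diff_distrib
      matrix_vector_mul_assoc matrix_mul_assoc matrix_vector_mult_scaleR linear_neg[OF matrix_vector_mul_linear]
      del: transpose_matrix_vector)

lemma q_marginal_law_z: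
  fixes q p :: "real \<Rightarrow> 'w \<Rightarrow> real^'n"
  assumes "q t \<in> borel_measurable M" and "p t \<in> borel_measurable M"
  shows "q_marginal (law_z M q p t) = distr M borel (q t)"
proof -
  have "(\<lambda>\<omega>. (q t \<omega>, p t \<omega>)) \<in> borel_measurable M"
    using assms by (rule borel_measurable_Pair)
  moreover have "fst \<in> (borel :: ((real^'n) \<times> (real^'n)) measure) \<rightarrow>\<^sub>M borel"
    by (intro borel_measurable_continuous_onI continuous_intros)
  ultimately show ?thesis
    unfolding q_marginal_def law_z_def by (simp add: distr_distr o_def)
qed

text \<open>The equation depends on the law of its own solution, so the position marginal of the new
  process must first be identified as the affine image of the old one; only then does
  \<open>covariance_affine\<close> apply.\<close>

lemma mean_field_solution_affine:
  fixes A :: "real^'n^'n" and S :: "real \<Rightarrow> real^'m^'n"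
  assumes \<Phi>: "\<And>x. \<Phi> differentiable at x"
    and sol: "mean_field_solution \<gamma> (\<lambda>x. \<Phi> (A *v x + b)) S M F W T v u"
  shows "mean_field_solution \<gamma> \<Phi> (\<lambda>t. A ** S t) M F W T (\<lambda>t \<omega>. A *v v t \<omega> + b) (\<lambda>t \<omega>. A *v u t \<omega>)"
proof -
  let ?q = "\<lambda>t \<omega>. A *v v t \<omega> + b" and ?p = "\<lambda>t \<omega>. A *v u t \<omega>"
  define \<mu> \<mu>' where "\<mu> t = q_marginal (law_z M v u t)" and "\<mu>' t = q_marginal (law_z M ?q ?p t)" for t
  have F: "filtered_prob_space M F" and W: "standard_brownian_motion M F W"
    and S: "\<And>t. t \<in> {0..T} \<Longrightarrow> finite_second_moment (\<mu> t) \<and> S t ** transpose (S t) = covariance (\<mu> t)"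
    and sde: "second_order_sde M F W T
         (\<lambda>t \<omega>. langevin_drift \<gamma> (\<lambda>x. \<Phi> (A *v x + b)) (covariance (\<mu> t)) (v t \<omega>) (u t \<omega>))
         (\<lambda>t \<omega>. sqrt (2 * \<gamma>) *\<^sub>R S t) v u"
    using sol by (auto simp: mean_field_solution_def \<mu>_def Let_def)
  interpret prob_space M using F by (simp add: filtered_prob_space_def)
  \<comment> \<open>Adaptedness is known only at times in \<open>{0..T}\<close>; elsewhere the law
    could be a meaningless \<open>distr\<close>, hence the time restriction in all that
    follows.\<close>
  have meas: "v t \<in> borel_measurable M" "u t \<in> borel_measurable M" if "t \<in> {0..T}" for t
    using that sde F measurable_from_subalg
    unfolding second_order_sde_def filtered_prob_space_def by blast+
  have \<mu>: "\<mu> t = distr M borel (v t)" if "t \<in> {0..T}" for t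
    unfolding \<mu>_def using meas[OF that] by (rule q_marginal_law_z)
  have \<mu>': "\<mu>' t = distr (\<mu> t) borel (\<lambda>x. A *v x + b)" if "t \<in> {0..T}" for t
  proof -
    have "\<mu>' t = distr M borel (?q t)"
      unfolding \<mu>'_def using meas[OF that]
      by (intro q_marginal_law_z borel_measurable_add borel_measurable_matrix_vector) auto
    then show ?thesis
      unfolding \<mu>[OF that] by (simp add: distr_distr[OF borel_measurable_affine meas(1)[OF that]] o_def)
  qed
  have prob: "prob_space (\<mu> t)" and sets: "sets (\<mu> t) = sets borel" if "t \<in> {0..T}" for t
    using meas(1)[OF that] by (simp_all add: \<mu>[OF that] prob_space_distr)
  have fsm: "finite_second_moment (\<mu>' t)"
    and cov: "covariance (\<mu>' t) = A ** covariance (\<mu> t) ** transpose A" if "t \<in> {0..T}" for t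
    unfolding \<mu>'[OF that] using prob[OF that] sets[OF that] S[OF that]
    by (simp_all add: finite_second_moment_affine covariance_affine)
  have "second_order_sde M F W T
         (\<lambda>t \<omega>. langevin_drift \<gamma> \<Phi> (covariance (\<mu>' t)) (?q t \<omega>) (?p t \<omega>))
         (\<lambda>t \<omega>. sqrt (2 * \<gamma>) *\<^sub>R (A ** S t)) ?q ?p"
    by (rule second_order_sde_affine[OF F W sde])
      (simp_all only: cov langevin_drift_affine[OF \<Phi>]
        linear_scale[OF bounded_linear.linear[OF bounded_linear_matrix_matrix_mult]])
  moreover have "A ** S t ** transpose (A ** S t) = covariance (\<mu>' t)" if "t \<in> {0..T}" for t
    using S[OF that] by (metis cov[OF that] matrix_transpose_mul matrix_mul_assoc)
  ultimately show ?thesis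
    using F W fsm by (simp add: mean_field_solution_def \<mu>'_def)
qed

text \<open>The inverse map is written with the shift \<open>- (matrix_inv A *v b)\<close> added, so
  that lemmas about \<open>A *v x + b\<close> apply to it literally.\<close>

lemma affine_inverse:
  fixes A :: "real^'n^'n"
  assumes "invertible A"
  shows "A *v (matrix_inv A *v x + - (matrix_inv A *v b)) + b = x"
    and "matrix_inv A *v (A *v x + b) + - (matrix_inv A *v b) = x"
  by (simp_all add: matrix_vector_right_distrib matrix_vector_mult_diff_distrib matrix_inv_cancel[OF assms])

lemma mean_field_solution_affine_iff:
  fixes A :: "real^'n^'n" and S :: "real \<Rightarrow> real^'m^'n"
  assumes A: "invertible A" and \<Phi>: "\<And>x. \<Phi> differentiable at x"
  shows "mean_field_solution \<gamma> \<Phi> S M F W T (\<lambda>t \<omega>. A *v v t \<omega> + b) (\<lambda>t \<omega>. A *v u t \<omega>)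
    \<longleftrightarrow> mean_field_solution \<gamma> (\<lambda>x. \<Phi> (A *v x + b)) (\<lambda>t. matrix_inv A ** S t) M F W T v u"
    (is "?L \<longleftrightarrow> ?R")
proof
  assume ?R
  from mean_field_solution_affine[OF \<Phi> this] show ?L
    by (simp only: matrix_inv_cancel[OF A])
next
  assume L: ?L
  have "(\<lambda>x. \<Phi> (A *v x + b)) differentiable at x" for x
    using differentiable_chain_at[of "\<lambda>x. A *v x + b" x \<Phi>] \<Phi> has_derivative_affine[of A b x UNIV]
    by (auto simp: o_def differentiable_def)
  \<comment> \<open>\<open>\<Phi>\<close> is rewritten as the composed potential seen through the
    inverse map. In this direction the composed potential plays the role of \<open>\<Phi>\<close>,
    which is why its differentiability was established just before.\<close>
  moreover have "mean_field_solution \<gamma>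
     (\<lambda>x. \<Phi> (A *v (matrix_inv A *v x + - (matrix_inv A *v b)) + b)) S M F W T
     (\<lambda>t \<omega>. A *v v t \<omega> + b) (\<lambda>t \<omega>. A *v u t \<omega>)"
    using L by (simp only: affine_inverse[OF A])
  ultimately have "mean_field_solution \<gamma> (\<lambda>x. \<Phi> (A *v x + b)) (\<lambda>t. matrix_inv A ** S t) M F W T
     (\<lambda>t \<omega>. matrix_inv A *v (A *v v t \<omega> + b) + - (matrix_inv A *v b)) (\<lambda>t \<omega>. matrix_inv A *v (A *v u t \<omega>))"
    by (rule mean_field_solution_affine)
  then show ?R
    by (simp only: affine_inverse[OF A] matrix_inv_cancel[OF A])
qed

section \<open>Interacting particles\<close>

lemma ensemble_mean_affine:
  fixes A :: "real^'n^'m" and x :: "'i::finite \<Rightarrow> real^'n"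
  shows "ensemble_mean (\<lambda>i. A *v x i + b) = A *v ensemble_mean x + b"
  unfolding ensemble_mean_def
  by (simp add: sum.distrib scaleR_right_distrib linear_sum[OF matrix_vector_mul_linear] matrix_vector_mult_scaleR
      sum_constant_scaleR del: sum_constant)

lemma deviation_matrix_affine:
  fixes A :: "real^'n^'m" and x :: "'i::finite \<Rightarrow> real^'n"
  shows "deviation_matrix (\<lambda>i. A *v x i + b) = A ** deviation_matrix x"
proof -
  have "(A *v x i + b - (A *v ensemble_mean x + b)) = A *v (x i - ensemble_mean x)" for i
    by (simp add: matrix_vector_mult_diff_distrib)
  then show ?thesis
    unfolding deviation_matrix_def ensemble_mean_affine
    by (simp add: vec_eq_iff matrix_matrix_mult_def matrix_vector_mult_def)
qed

lemma ensemble_covariance_affine: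
  fixes A :: "real^'n^'m" and x :: "'i::finite \<Rightarrow> real^'n"
  shows "ensemble_covariance (\<lambda>i. A *v x i + b) = A ** ensemble_covariance x ** transpose A"
  unfolding ensemble_covariance_def deviation_matrix_affine
  by (simp add: matrix_transpose_mul matrix_mul_assoc scalar_matrix_assoc
      linear_scale[OF bounded_linear.linear[OF bounded_linear_matrix_matrix_mult]])

text \<open>The square root is prescribed here, with no freedom to choose it in the new variables.
  It picks up \<open>A\<close> on the left because the deviations do; a symmetric square root would
  in general not behave this way.\<close>

lemma ensemble_sqrt_covariance_affine:
  fixes A :: "real^'n^'m" and x :: "'i::finite \<Rightarrow> real^'n"
  shows "ensemble_sqrt_covariance (\<lambda>i. A *v x i + b) = A ** ensemble_sqrt_covariance x"
  unfolding ensemble_sqrt_covariance_def deviation_matrix_affine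
  by (simp add: linear_scale[OF bounded_linear.linear[OF bounded_linear_matrix_matrix_mult]])

text \<open>Both particle systems have the same diffusion, which is already known to transform, so
  only the equivariance of the drift remains as a hypothesis. That hypothesis concerns
  configurations, not laws.\<close>

lemma particle_solution_affine:
  fixes A :: "real^'n^'k" and v u :: "'i::finite \<Rightarrow> real \<Rightarrow> 'w \<Rightarrow> real^'n"
  assumes drift: "\<And>x i p. drift (\<lambda>k. A *v x k + b) i (A *v p) = A *v drift' x i p"
    and sol: "particle_solution \<gamma> drift' M F W T v u"
  shows "particle_solution \<gamma> drift M F W T (\<lambda>i t \<omega>. A *v v i t \<omega> + b) (\<lambda>i t \<omega>. A *v u i t \<omega>)"
proof -
  from sol have F: "filtered_prob_space M F" and W: "independent_brownian_motions M F W"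
    and sde: "\<And>i. second_order_sde M F (W i) T
        (\<lambda>t \<omega>. drift' (\<lambda>k. v k t \<omega>) i (u i t \<omega>))
        (\<lambda>t \<omega>. sqrt (2 * \<gamma>) *\<^sub>R ensemble_sqrt_covariance (\<lambda>k. v k t \<omega>)) (v i) (u i)"
    by (auto simp: particle_solution_def)
  have "second_order_sde M F (W i) T
        (\<lambda>t \<omega>. drift (\<lambda>k. A *v v k t \<omega> + b) i (A *v u i t \<omega>))
        (\<lambda>t \<omega>. sqrt (2 * \<gamma>) *\<^sub>R ensemble_sqrt_covariance (\<lambda>k. A *v v k t \<omega> + b))
        (\<lambda>t \<omega>. A *v v i t \<omega> + b) (\<lambda>t \<omega>. A *v u i t \<omega>)" for i
  proof (rule second_order_sde_affine[OF F _ sde])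
    show "standard_brownian_motion M F (W i)"
      using W by (simp add: independent_brownian_motions_def)
  qed (simp_all only: drift ensemble_sqrt_covariance_affine
        linear_scale[OF bounded_linear.linear[OF bounded_linear_matrix_matrix_mult]])
  then show ?thesis using F W by (simp add: particle_solution_def)
qed

lemma particle_solution_affine_iff:
  fixes A :: "real^'n^'n" and v u :: "'i::finite \<Rightarrow> real \<Rightarrow> 'w \<Rightarrow> real^'n"
  assumes A: "invertible A"
    and drift: "\<And>x i p. drift (\<lambda>k. A *v x k + b) i (A *v p) = A *v drift' x i p"
  shows "particle_solution \<gamma> drift M F W T (\<lambda>i t \<omega>. A *v v i t \<omega> + b) (\<lambda>i t \<omega>. A *v u i t \<omega>)
    \<longleftrightarrow> particle_solution \<gamma> drift' M F W T v u" (is "?L \<longleftrightarrow> ?R")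
proof
  assume ?R
  with drift show ?L by (rule particle_solution_affine)
next
  assume L: ?L
  let ?b = "- (matrix_inv A *v b)"
  \<comment> \<open>Equivariance under the inverse map: the given one is evaluated at the preimage
    and multiplied by \<open>matrix_inv A\<close>.\<close>
  have "drift' (\<lambda>k. matrix_inv A *v x k + ?b) i (matrix_inv A *v p) = matrix_inv A *v drift x i p" for x i p
    using arg_cong[OF drift[of "\<lambda>k. matrix_inv A *v x k + ?b" i "matrix_inv A *v p"], of "(*v) (matrix_inv A)"]
    by (simp only: affine_inverse[OF A] matrix_inv_cancel[OF A])
  from particle_solution_affine[of drift', OF this L] show ?R
    by (simp only: affine_inverse[OF A] matrix_inv_cancel[OF A])
qed

lemma ensemble_drift_affine:
  fixes A :: "real^'n^'m" and x :: "'i::finite \<Rightarrow> real^'n"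
  assumes "\<And>x. \<Phi> differentiable at x"
  shows "ensemble_drift \<gamma> \<Phi> (\<lambda>k. A *v x k + b) i (A *v p)
    = A *v ensemble_drift \<gamma> (\<lambda>x. \<Phi> (A *v x + b)) x i p"
  unfolding ensemble_drift_def ensemble_covariance_affine using assms by (rule langevin_drift_affine)

text \<open>Serves for the values \<open>G (x k)\<close> rather than for positions: it makes the
  weights of the gradient-free drift add up to 0.\<close>

lemma sum_deviations:
  fixes x :: "'i::finite \<Rightarrow> real^'n"
  shows "(\<Sum>k\<in>UNIV. x k - ensemble_mean x) = 0"
  by (simp add: sum_subtractf ensemble_mean_def sum_constant_scaleR del: sum_constant)

text \<open>The field \<open>g\<close> is made to transform like a gradient, so the covariance term
  behaves as in \<open>langevin_drift_affine\<close>. The weights involve only values of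
  \<open>G\<close>, which agree in both coordinate systems, and the positions enter the sum
  linearly.\<close>

lemma gradient_free_drift_affine:
  fixes A :: "real^'n^'m" and x :: "'i::finite \<Rightarrow> real^'n" and G :: "real^'m \<Rightarrow> real^'j"
  shows "gradient_free_drift \<gamma> \<Gamma> y G g (\<lambda>k. A *v x k + b) i (A *v p)
    = A *v gradient_free_drift \<gamma> \<Gamma> y (\<lambda>x. G (A *v x + b)) (\<lambda>x. transpose A *v g (A *v x + b)) x i p"
proof -
  \<comment> \<open>The weights add up to 0, so the translation by \<open>b\<close> does not contribute to the sum.\<close>
  define w where "w k = weighted_inner \<Gamma> (G (A *v x k + b) - ensemble_mean (\<lambda>l. G (A *v x l + b)))
      (G (A *v x i + b) - y)" for k
  have "(\<Sum>k\<in>UNIV. w k) = 0"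
    unfolding w_def weighted_inner_def inner_sum_left[symmetric] sum_deviations by simp
  then have "(\<Sum>k\<in>UNIV. w k *\<^sub>R (A *v x k + b)) = A *v (\<Sum>k\<in>UNIV. w k *\<^sub>R x k)"
    by (simp add: scaleR_right_distrib sum.distrib scaleR_sum_left[symmetric]
        linear_sum[OF matrix_vector_mul_linear] matrix_vector_mult_scaleR)
  then show ?thesis
    unfolding gradient_free_drift_def w_def[symmetric] ensemble_covariance_affine
    by (simp add: matrix_vector_mult_diff_distrib linear_neg[OF matrix_vector_mul_linear]
        matrix_vector_mul_assoc matrix_mul_assoc matrix_vector_mult_scaleR
        del: transpose_matrix_vector)
qed

text \<open>Definiteness gives a trivial kernel, hence invertibility; transposing
  \<open>matrix_inv B ** B = mat 1\<close> then shows the transposed inverse to be a right inverse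
  of \<open>B\<close>.\<close>

lemma matrix_inv_symmetric:
  assumes "symmetric_positive_definite B"
  shows "transpose (matrix_inv B) = matrix_inv B"
proof -
  have B: "transpose B = B" using assms by (simp add: symmetric_positive_definite_def)
  have "x = 0" if "B *v x = 0" for x
    using assms that by (fastforce simp: symmetric_positive_definite_def)
  then have inv: "invertible B"
    using invertible_left_inverse matrix_left_invertible_ker by blast
  have "B ** transpose (matrix_inv B) = mat 1"
    by (metis B inv matrix_inv_cancel(2) matrix_transpose_mul transpose_mat)
  then show ?thesis
    by (metis inv matrix_inv_cancel(4) matrix_mul_rid)
qed

text \<open>Brings the gradient of the transformed regularization to the shape
  \<open>transpose A *v g (A *v x + b)\<close> of \<open>gradient_free_drift_affine\<close>.
  Symmetry of the inverse merges the two terms of the product rule and cancels the factor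
  1/2.\<close>

lemma gradient_regularization_affine:
  fixes A :: "real^'n^'m"
  assumes "symmetric_positive_definite B"
  shows "gradient (\<lambda>x. regularization B (A *v x + b)) = (\<lambda>x. transpose A *v (matrix_inv B *v (A *v x + b)))"
proof
  fix x
  have "GDERIV (regularization B) q :> matrix_inv B *v q" for q
  proof -
    have "(regularization B has_derivative
        (\<lambda>h. 1 / 2 * (q \<bullet> (matrix_inv B *v h) + h \<bullet> (matrix_inv B *v q)))) (at q)"
      unfolding regularization_def[abs_def] weighted_inner_def
      by (intro has_derivative_mult_right has_derivative_inner has_derivative_ident
          bounded_linear_imp_has_derivative matrix_vector_mul_bounded_linear)
    moreover have "q \<bullet> (matrix_inv B *v h) = h \<bullet> (matrix_inv B *v q)" for h
      using inner_matrix_transpose[of "matrix_inv B" h q] matrix_inv_symmetric[OF assms]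
      by (simp add: inner_commute)
    ultimately show ?thesis unfolding gderiv_def by simp
  qed
  note grad = this
  then have "regularization B differentiable at q" for q
    unfolding gderiv_def differentiable_def by blast
  from gradient_affine[OF this] show "gradient (\<lambda>x. regularization B (A *v x + b)) x
      = transpose A *v (matrix_inv B *v (A *v x + b))"
    by (simp add: gradient_eqI[OF grad])
qed

section \<open>Linear change of variables for Lebesgue measure\<close>

lemma invertible_matrix_inv:
  fixes A :: "real^'n^'n"
  assumes "invertible A"
  shows "invertible (matrix_inv A)"
  using matrix_inv_cancel(1,2)[OF assms] unfolding invertible_def by blast

text \<open>The library's \<open>measure_linear_image\<close> asks for a well-ordered index type.\<close>

lemma measure_matrix_image_interval:
  fixes A :: "real^'n^'n"
  shows "det A \<noteq> 0 \<Longrightarrow> measure lebesgue ((*v) A ` cbox a b) = \<bar>det A\<bar> * measure lebesgue (cbox a b)"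
proof (induction A arbitrary: a b rule: induct_matrix_elementary_alt[case_names mult zero_row diagonal swap1 idplus])
  case (mult A B)
  then have "det A \<noteq> 0" "det B \<noteq> 0" by (auto simp: det_mul)
  have B: "(*v) B ` cbox a b \<in> lmeasurable"
    by (simp add: measurable_linear_image_interval)
  have "(*v) (A ** B) ` cbox a b = (*v) A ` (*v) B ` cbox a b"
    by (simp add: image_image matrix_vector_mul_assoc)
  \<comment> \<open>The image of a box under \<open>B\<close> need not be a box, so the induction
    hypothesis for \<open>A\<close> is first extended from boxes to measurable sets.\<close>
  also have "measure lebesgue \<dots> = \<bar>det A\<bar> * measure lebesgue ((*v) B ` cbox a b)"
    using measure_linear_sufficient[OF matrix_vector_mul_linear B mult.IH(1)] \<open>det A \<noteq> 0\<close> by metis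
  also have "\<dots> = \<bar>det (A ** B)\<bar> * measure lebesgue (cbox a b)"
    using mult.IH(2)[OF \<open>det B \<noteq> 0\<close>] by (simp add: det_mul abs_mult)
  finally show ?case .
next
  case (zero_row A i)
  then show ?case by (simp add: det_zero_row(1))
next
  case (diagonal A)
  have "(\<Sum>j\<in>UNIV. A $ k $ j * x $ j) = A $ k $ k * x $ k" for k and x :: "real^'n"
    using diagonal.hyps by (simp add: sum.remove[where x = k])
  then have "(*v) A = (\<lambda>x. \<chi> k. A $ k $ k * x $ k)"
    by (simp add: fun_eq_iff matrix_vector_mult_def)
  moreover have "det A = (\<Prod>k\<in>UNIV. A $ k $ k)"
    using diagonal.hyps by (rule det_diagonal)
  ultimately show ?case
    using measure_stretch[of "cbox a b" "\<lambda>k. A $ k $ k"] by simp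
next
  case (swap1 m n)
  \<comment> \<open>The matrix permutes coordinates by an involution, so boxes go to boxes with the
    same side lengths in another order.\<close>
  define p where "p = Transposition.transpose m n"
  have p: "p permutes UNIV" "p (p i) = i" for i
    by (simp_all add: p_def permutes_swap_id)
  have "\<bar>of_int (sign p) :: real\<bar> = 1"
    by (simp add: sign_def)
  then have det: "\<bar>det (\<chi> i j. mat 1 $ i $ p j :: real^'n^'n)\<bar> = 1"
    by (simp add: det_permute_columns[OF p(1)] abs_mult)
  have "(\<chi> i j. mat 1 $ i $ p j :: real^'n^'n) = (\<chi> i j. if j = p i then 1 else 0)"
    by (auto simp: vec_eq_iff mat_def p(2))
  then have "(*v) (\<chi> i j. mat 1 $ i $ p j) = (\<lambda>x :: real^'n. \<chi> i. x $ p i)"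
    by (simp add: fun_eq_iff vec_eq_iff matrix_vector_mult_def if_distrib[of "\<lambda>c. c * _"] cong: if_cong)
  moreover have "(\<lambda>x :: real^'n. \<chi> i. x $ p i) ` cbox a b = cbox (\<chi> i. a $ p i) (\<chi> i. b $ p i)"
  proof (intro subset_antisym subsetI)
    fix x assume x: "x \<in> cbox (\<chi> i. a $ p i) (\<chi> i. b $ p i)"
    then have "a $ i \<le> x $ p i \<and> x $ p i \<le> b $ i" for i
      using p(2)[of i] by (auto simp: mem_box_cart) metis+
    then have "(\<chi> i. x $ p i) \<in> cbox a b" by (simp add: mem_box_cart)
    moreover have "x = (\<chi> i. (\<chi> i. x $ p i) $ p i)" by (simp add: p(2) vec_eq_iff)
    ultimately show "x \<in> (\<lambda>x. \<chi> i. x $ p i) ` cbox a b" by blast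
  qed (auto simp: mem_box_cart)
  moreover have "measure lebesgue (cbox (\<chi> i. a $ p i) (\<chi> i. b $ p i)) = measure lebesgue (cbox a b)"
  proof -
    have "(\<forall>i. a $ p i \<le> b $ p i) \<longleftrightarrow> (\<forall>i. a $ i \<le> b $ i)" using p(2) by metis
    then have "cbox (\<chi> i. a $ p i) (\<chi> i. b $ p i) \<noteq> {} \<longleftrightarrow> cbox a b \<noteq> {}"
      unfolding interval_ne_empty_cart by simp
    moreover have "(\<Prod>i\<in>UNIV. b $ p i - a $ p i) = (\<Prod>i\<in>UNIV. b $ i - a $ i)"
      using prod.permute[OF p(1), of "\<lambda>i. b $ i - a $ i"] by (simp add: o_def)
    ultimately show ?thesis
      by (simp add: content_cbox_if_cart)
  qed
  ultimately show ?case using det unfolding p_def by simp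
next
  case (idplus m n)
  let ?E = "\<chi> i j. of_bool (i = m \<and> j = n \<or> i = j) :: real^'n^'n"
  \<comment> \<open>A shear is the identity after one row operation, hence has determinant
    1.\<close>
  have "?E = (\<chi> k. if k = m then row m (mat 1) + 1 *s row n (mat 1) else row k (mat 1))"
    using idplus.hyps by (auto simp: vec_eq_iff row_def mat_def)
  then have det: "det ?E = 1"
    using det_row_operation[OF idplus.hyps, of "mat 1 :: real^'n^'n" 1] by (simp only: det_I)
  let ?f = "\<lambda>x :: real^'n. \<chi> i. if i = m then x $ m + x $ n else x $ i"
  have f: "(*v) ?E = ?f"
  proof
    fix x :: "real^'n"
    have "(\<Sum>j\<in>UNIV. of_bool (i = m \<and> j = n \<or> i = j) * x $ j) = (if i = m then x $ m + x $ n else x $ i)" for i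
    proof -
      have *: "of_bool (i = m \<and> j = n \<or> i = j) * x $ j
          = (if j = i then x $ j else 0) + (if j = n then of_bool (i = m) * x $ j else 0)" for j
        using idplus.hyps by auto
      show ?thesis
        unfolding * by (simp add: sum.distrib)
    qed
    then show "?E *v x = ?f x" by (simp add: vec_eq_iff matrix_vector_mult_def)
  qed
  have "measure lebesgue ((*v) ?E ` cbox a b) = measure lebesgue (cbox a b)"
  proof (cases "cbox a b = {}")
    case False
    \<comment> \<open>\<open>measure_shear_interval\<close> applies only to intervals with a nonnegative lower \<open>n\<close>-th coordinate.\<close>
    have "cbox a b = (+) a ` cbox 0 (b - a)"
      by (simp add: cbox_translation[symmetric])
    then have "(*v) ?E ` cbox a b = (+) (?E *v a) ` ((*v) ?E ` cbox 0 (b - a))"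
      by (simp add: image_image matrix_vector_right_distrib)
    then have "measure lebesgue ((*v) ?E ` cbox a b) = measure lebesgue ((*v) ?E ` cbox 0 (b - a))"
      by (simp only: measure_translation)
    also have "\<dots> = measure lebesgue (cbox 0 (b - a))"
      unfolding f using False idplus.hyps
      by (intro measure_shear_interval) (auto simp: interval_eq_empty_cart)
    also have "\<dots> = measure lebesgue (cbox a b)"
      using \<open>cbox a b = (+) a ` cbox 0 (b - a)\<close> by (simp only: measure_translation)
    finally show ?thesis .
  qed simp
  then show ?case by (simp only: det abs_one mult_1)
qed

lemma measure_matrix_image:
  fixes A :: "real^'n^'n"
  assumes "invertible A" and "S \<in> lmeasurable"
  shows "(*v) A ` S \<in> lmeasurable" and "measure lebesgue ((*v) A ` S) = \<bar>det A\<bar> * measure lebesgue S"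
  using measure_linear_sufficient[OF matrix_vector_mul_linear assms(2) measure_matrix_image_interval] assms(1)
  by (simp_all add: invertible_det_nz)

text \<open>Lebesgue measure is determined by boxes. The preimage of a box is the image of a shifted
  box under \<open>matrix_inv A\<close>, and the determinants of \<open>A\<close> and its inverse
  multiply to 1.\<close>

lemma lborel_affine_matrix:
  fixes A :: "real^'n^'n"
  assumes A: "invertible A"
  shows "lborel = density (distr lborel borel (\<lambda>x. A *v x + b)) (\<lambda>_. ennreal \<bar>det A\<bar>)"
proof (rule lborel_eqI)
  fix l u :: "real^'n" assume lu: "\<And>k. k \<in> Basis \<Longrightarrow> l \<bullet> k \<le> u \<bullet> k"
  let ?f = "\<lambda>x. A *v x + b" and ?S = "(*v) (matrix_inv A) ` box (l - b) (u - b)"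
  have meas: "?f \<in> lborel \<rightarrow>\<^sub>M borel"
    using borel_measurable_affine by simp
  have pre: "?f -` box l u = ?S"
  proof (intro subset_antisym subsetI)
    fix x assume "x \<in> ?f -` box l u"
    then have "A *v x \<in> box (l - b) (u - b)"
      by (auto simp: mem_box inner_diff_left inner_add_left algebra_simps)
    then show "x \<in> ?S" using matrix_inv_cancel(6)[OF A, of x] by force
  next
    fix x assume "x \<in> ?S"
    then show "x \<in> ?f -` box l u"
      by (auto simp: matrix_inv_cancel[OF A] mem_box inner_diff_left inner_add_left algebra_simps)
  qed
  have "?f -` box l u \<in> sets borel"
    using measurable_sets[OF borel_measurable_affine, of "box l u" A b] by simp
  then have S: "?S \<in> sets borel" by (simp only: pre)
  have box: "box (l - b) (u - b) \<in> lmeasurable" by simp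
  have inv: "invertible (matrix_inv A)" using A by (rule invertible_matrix_inv)
  have "\<bar>det A\<bar> * \<bar>det (matrix_inv A)\<bar> = 1"
    by (simp add: abs_mult[symmetric] det_mul[symmetric] matrix_inv_cancel[OF A])
  then have "\<bar>det A\<bar> * measure lebesgue ?S = measure lebesgue (box (l - b) (u - b))"
    by (simp only: measure_matrix_image(2)[OF inv box] mult.assoc[symmetric] mult_1)
  also have "\<dots> = (\<Prod>k\<in>Basis. (u - l) \<bullet> k)"
    using lu by (simp add: measure_lborel_box_eq inner_diff_left)
  finally have vol: "\<bar>det A\<bar> * measure lebesgue ?S = (\<Prod>k\<in>Basis. (u - l) \<bullet> k)" .
  \<comment> \<open>The volume formula concerns the completed measure; it transfers because
    \<open>?S\<close> is Borel.\<close>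
  have "emeasure lborel ?S = emeasure lebesgue ?S"
    using S by (simp add: emeasure_completion)
  also have "\<dots> = ennreal (measure lebesgue ?S)"
    using measure_matrix_image(1)[OF inv box] by (simp add: emeasure_eq_measure2)
  finally have "emeasure lborel ?S = ennreal (measure lebesgue ?S)" .
  then show "emeasure (density (distr lborel borel ?f) (\<lambda>_. ennreal \<bar>det A\<bar>)) (box l u) = (\<Prod>k\<in>Basis. (u - l) \<bullet> k)"
    by (simp add: emeasure_density nn_integral_cmult_indicator emeasure_distr[OF meas] pre
        vol[symmetric] ennreal_mult)
qed simp

lemma nn_integral_affine_matrix:
  fixes A :: "real^'n^'n"
  assumes "invertible A" and h: "h \<in> borel_measurable borel"
  shows "(\<integral>\<^sup>+ x. h x \<partial>lborel) = ennreal \<bar>det A\<bar> * (\<integral>\<^sup>+ x. h (A *v x + b) \<partial>lborel)"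
proof -
  have meas: "(\<lambda>x. A *v x + b) \<in> lborel \<rightarrow>\<^sub>M borel"
    using borel_measurable_affine by simp
  have "(\<integral>\<^sup>+ x. h x \<partial>lborel)
      = (\<integral>\<^sup>+ x. h x \<partial>density (distr lborel borel (\<lambda>x. A *v x + b)) (\<lambda>_. ennreal \<bar>det A\<bar>))"
    using lborel_affine_matrix[OF assms(1), of b] by simp
  also have "\<dots> = ennreal \<bar>det A\<bar> * (\<integral>\<^sup>+ x. h x \<partial>distr lborel borel (\<lambda>x. A *v x + b))"
    using h by (simp add: nn_integral_density nn_integral_cmult)
  also have "(\<integral>\<^sup>+ x. h x \<partial>distr lborel borel (\<lambda>x. A *v x + b)) = (\<integral>\<^sup>+ x. h (A *v x + b) \<partial>lborel)"
    using meas by (rule nn_integral_distr) (use h in simp)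
  finally show ?thesis .
qed

section \<open>Fokker--Planck equation\<close>

text \<open>Instances with \<open>b = 0\<close> serve as the linear parts: the derivative, the
  adjoint acting on gradients, and the conjugation of the flux.\<close>

definition phase_map :: "real^'n^'n \<Rightarrow> real^'n \<Rightarrow> (real^'n) \<times> (real^'n) \<Rightarrow> (real^'n) \<times> (real^'n)" where
  "phase_map A b z = (A *v fst z + b, A *v snd z)"

lemma phase_map_inverse:
  assumes "invertible A"
  shows "phase_map (matrix_inv A) (- (matrix_inv A *v b)) (phase_map A b z) = z"
    and "phase_map A b (phase_map (matrix_inv A) (- (matrix_inv A *v b)) z) = z"
  unfolding phase_map_def
  by (simp_all only: fst_conv snd_conv affine_inverse[OF assms] matrix_inv_cancel[OF assms] prod.collapse)

lemma borel_measurable_phase_map: "phase_map A b \<in> borel_measurable borel"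
  unfolding phase_map_def[abs_def]
  by (intro borel_measurable_continuous_onI continuous_intros
      linear_continuous_on_compose[OF _ matrix_vector_mul_linear])

text \<open>Tonelli and the change of variables in each block separately; the square collects one
  factor from positions and one from momenta.\<close>

lemma nn_integral_phase_map:
  fixes A :: "real^'n^'n"
  assumes A: "invertible A" and h: "h \<in> borel_measurable borel"
  shows "(\<integral>\<^sup>+ z. h z \<partial>lborel) = ennreal (\<bar>det A\<bar>\<^sup>2) * (\<integral>\<^sup>+ z. h (phase_map A b z) \<partial>lborel)"
proof -
  have h': "h \<in> borel_measurable (lborel \<Otimes>\<^sub>M lborel)"
    using h by (simp add: lborel_prod)
  have hT: "(\<lambda>z. h (phase_map A b z)) \<in> borel_measurable (lborel \<Otimes>\<^sub>M lborel)"
    using measurable_compose[OF borel_measurable_phase_map h] by (simp add: lborel_prod)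
  have sec: "(\<lambda>y. h (x, y)) \<in> borel_measurable borel" for x
    using measurable_Pair2[OF h', of x] by simp
  have int: "(\<lambda>x. \<integral>\<^sup>+ y. h (x, y) \<partial>lborel) \<in> borel_measurable borel"
    using lborel.borel_measurable_nn_integral_fst[OF h'] by simp
  have int': "(\<lambda>x. \<integral>\<^sup>+ y. h (phase_map A b (x, y)) \<partial>lborel) \<in> borel_measurable lborel"
    using lborel.borel_measurable_nn_integral_fst[OF hT] by simp
  have "(\<integral>\<^sup>+ z. h z \<partial>lborel) = (\<integral>\<^sup>+ x. \<integral>\<^sup>+ y. h (x, y) \<partial>lborel \<partial>lborel)"
    using lborel.nn_integral_fst[OF h'] by (simp add: lborel_prod)
  also have "\<dots> = ennreal \<bar>det A\<bar> * (\<integral>\<^sup>+ x. \<integral>\<^sup>+ y. h (A *v x + b, y) \<partial>lborel \<partial>lborel)"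
    by (rule nn_integral_affine_matrix[OF A int])
  also have "\<dots> = ennreal \<bar>det A\<bar> * (\<integral>\<^sup>+ x. ennreal \<bar>det A\<bar> * (\<integral>\<^sup>+ y. h (phase_map A b (x, y)) \<partial>lborel) \<partial>lborel)"
    using nn_integral_affine_matrix[OF A sec, of _ 0] by (simp add: phase_map_def)
  also have "\<dots> = ennreal \<bar>det A\<bar> * (ennreal \<bar>det A\<bar> * (\<integral>\<^sup>+ x. \<integral>\<^sup>+ y. h (phase_map A b (x, y)) \<partial>lborel \<partial>lborel))"
    by (subst nn_integral_cmult[OF int']) simp
  also have "(\<integral>\<^sup>+ x. \<integral>\<^sup>+ y. h (phase_map A b (x, y)) \<partial>lborel \<partial>lborel) = (\<integral>\<^sup>+ z. h (phase_map A b z) \<partial>lborel)"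
    using lborel.nn_integral_fst[OF hT] by (simp add: lborel_prod)
  finally show ?thesis
    by (simp only: power2_eq_square ennreal_mult[OF abs_ge_zero abs_ge_zero] mult.assoc)
qed

text \<open>Identifies the transformed density as that of the variables (v, u), the image of (q, p)
  under the inverse map, so that its covariance follows from \<open>covariance_affine\<close> with
  \<open>matrix_inv A\<close>.\<close>

lemma density_phase_map:
  fixes A :: "real^'n^'n"
  assumes A: "invertible A" and [measurable]: "\<rho> \<in> borel_measurable borel"
  shows "density lborel (\<lambda>z. ennreal (\<bar>det A\<bar>\<^sup>2 * \<rho> (phase_map A b z)))
    = distr (density lborel \<rho>) borel (phase_map (matrix_inv A) (- (matrix_inv A *v b)))"
    (is "?L = distr _ _ ?T'")
proof (rule measure_eqI)
  fix S assume "S \<in> sets ?L"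
  then have S[measurable]: "S \<in> sets borel" by simp
  have [measurable]: "phase_map A b \<in> borel_measurable borel" "?T' \<in> borel_measurable borel"
    by (rule borel_measurable_phase_map)+
  have ind: "indicator (?T' -` S) z = (indicator S (?T' z) :: ennreal)" for z
    by (simp add: indicator_def)
  have "emeasure (distr (density lborel \<rho>) borel ?T') S = (\<integral>\<^sup>+ z. ennreal (\<rho> z) * indicator S (?T' z) \<partial>lborel)"
    using measurable_sets[OF borel_measurable_phase_map S]
    by (simp add: emeasure_distr emeasure_density ind)
  also have "\<dots> = ennreal (\<bar>det A\<bar>\<^sup>2) * (\<integral>\<^sup>+ z. ennreal (\<rho> (phase_map A b z)) * indicator S z \<partial>lborel)"
    by (subst nn_integral_phase_map[OF A, where b = b]) (simp_all add: phase_map_inverse[OF A])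
  also have "\<dots> = emeasure ?L S"
    by (simp add: emeasure_density ennreal_mult' nn_integral_cmult[symmetric] mult.assoc)
  finally show "emeasure ?L S = emeasure (distr (density lborel \<rho>) borel ?T') S" ..
qed simp

lemma q_marginal_phase_map:
  assumes sets: "sets \<rho> = sets borel"
  shows "q_marginal (distr \<rho> borel (phase_map A b)) = distr (q_marginal \<rho>) borel (\<lambda>x. A *v x + b)"
proof -
  have fst: "fst \<in> (borel :: ((real^'n) \<times> (real^'n)) measure) \<rightarrow>\<^sub>M borel"
    by (intro borel_measurable_continuous_onI continuous_intros)
  then have fst': "fst \<in> borel_measurable \<rho>"
    unfolding measurable_cong_sets[OF sets refl] .
  have T: "phase_map A b \<in> borel_measurable \<rho>"
    using borel_measurable_phase_map unfolding measurable_cong_sets[OF sets refl] .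
  show ?thesis
    unfolding q_marginal_def distr_distr[OF fst T] distr_distr[OF borel_measurable_affine fst']
    by (simp add: o_def phase_map_def)
qed

lemma matrix_vector_mult_uminus:
  fixes C :: "real^'n^'m"
  shows "(- C) *v x = - (C *v x)"
  by (simp add: vec_eq_iff matrix_vector_mult_def sum_negf)

text \<open>Pulls a single \<open>C\<close> to the front of each block, where the transformation
  rule of the covariance can act.\<close>

lemma fp_flux_eq:
  "fp_flux \<gamma> H \<rho> z =
    (let C = density_covariance \<rho>; w = \<rho> z *\<^sub>R gradient H z + gradient \<rho> z
     in (- (C *v snd w), C *v (\<gamma> *\<^sub>R snd w + fst w)))"
  by (simp add: fp_flux_def fp_K_def fp_J_def block_matrix_def Let_def split_beta matrix_vector_right_distrib
      scaleR_matrix_vector_assoc[symmetric] matrix_vector_mult_scaleR matrix_vector_mult_uminus)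

section \<open>Gradient, flux and divergence under the phase-space map\<close>

lemma has_derivative_phase_map:
  "(phase_map A b has_derivative phase_map A 0) (at z)"
proof -
  have "((\<lambda>z. (A *v fst z + b, A *v snd z)) has_derivative (\<lambda>h. (A *v fst h + 0, A *v snd h))) (at z)"
    by (intro has_derivative_Pair has_derivative_add has_derivative_const
        bounded_linear.has_derivative[OF matrix_vector_mul_bounded_linear] has_derivative_fst has_derivative_snd
        has_derivative_ident)
  then show ?thesis by (simp add: phase_map_def[abs_def])
qed

lemma gradient_phase_map:
  assumes "f differentiable at (phase_map A b z)"
  shows "gradient (\<lambda>z. f (phase_map A b z)) z = phase_map (transpose A) 0 (gradient f (phase_map A b z))"
  using assms has_derivative_phase_map
  by (rule gradient_compose) (simp add: phase_map_def inner_prod_def inner_matrix_transpose)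

lemma differentiable_phase_map:
  assumes "f differentiable at (phase_map A b z)"
  shows "(\<lambda>z. f (phase_map A b z)) differentiable at z"
  using differentiable_chain_at[of "phase_map A b" z f] assms has_derivative_phase_map[of A b z]
  by (auto simp: o_def differentiable_def)

lemma GDERIV_cmult:
  assumes "GDERIV f x :> D"
  shows "GDERIV (\<lambda>x. c * f x) x :> c *\<^sub>R D"
  using has_derivative_mult_right[OF assms[unfolded gderiv_def], of c]
  by (simp add: gderiv_def)

text \<open>Both terms of the bracket are linear in the density and carry \<open>transpose A\<close>
  from the chain rule. It cancels the trailing transposed inverse of the new covariance and leaves
  \<open>matrix_inv A\<close> and the scalar \<open>c\<close>.\<close>

lemma fp_flux_phase_map:
  fixes A :: "real^'n^'n"
  assumes A: "invertible A"
    and H: "H differentiable at (phase_map A b z)" and \<rho>: "\<rho> differentiable at (phase_map A b z)"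
    and cov: "density_covariance (\<lambda>z. c * \<rho> (phase_map A b z))
      = matrix_inv A ** density_covariance \<rho> ** transpose (matrix_inv A)"
  shows "fp_flux \<gamma> (\<lambda>z. H (phase_map A b z)) (\<lambda>z. c * \<rho> (phase_map A b z)) z
    = c *\<^sub>R phase_map (matrix_inv A) 0 (fp_flux \<gamma> H \<rho> (phase_map A b z))"
proof -
  define w where "w = \<rho> (phase_map A b z) *\<^sub>R gradient H (phase_map A b z) + gradient \<rho> (phase_map A b z)"
  have grad: "gradient (\<lambda>z. c * \<rho> (phase_map A b z)) z = c *\<^sub>R phase_map (transpose A) 0 (gradient \<rho> (phase_map A b z))"
    using GDERIV_gradient[OF differentiable_phase_map[OF \<rho>]] gradient_phase_map[OF \<rho>]
    by (intro gradient_eqI GDERIV_cmult) simp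
  have w': "(c * \<rho> (phase_map A b z)) *\<^sub>R gradient (\<lambda>z. H (phase_map A b z)) z + gradient (\<lambda>z. c * \<rho> (phase_map A b z)) z
    = c *\<^sub>R phase_map (transpose A) 0 w"
    unfolding grad gradient_phase_map[OF H] w_def
    by (simp add: phase_map_def scaleR_right_distrib matrix_vector_right_distrib
        matrix_vector_mult_scaleR del: transpose_matrix_vector)
  have "transpose (matrix_inv A) ** transpose A = mat 1"
    by (metis matrix_transpose_mul matrix_inv_cancel(1)[OF A] transpose_mat)
  then have C: "matrix_inv A ** C ** transpose (matrix_inv A) *v (transpose A *v x) = matrix_inv A *v (C *v x)" for C x
    by (simp add: matrix_vector_mul_assoc del: transpose_matrix_vector flip: matrix_mul_assoc)
  show ?thesis
    unfolding fp_flux_eq Let_def w' cov w_def[symmetric]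
    by (simp add: phase_map_def matrix_vector_right_distrib matrix_vector_mult_scaleR C
        linear_neg[OF matrix_vector_mul_linear] scaleR_right_distrib scaleR_left_commute
        del: transpose_matrix_vector)
qed

lemma jacobian_eqI:
  fixes f :: "real^'n \<Rightarrow> real^'m"
  assumes "(f has_derivative (*v) J) (at x)"
  shows "jacobian f (at x) = J"
  using frechet_derivative_at[OF assms, symmetric] by (simp add: jacobian_def)

lemma trace_similar:
  fixes A :: "real^'n^'n"
  assumes "invertible A"
  shows "trace (matrix_inv A ** J ** A) = trace J"
  by (metis assms matrix_inv_cancel(1) matrix_mul_assoc matrix_mul_rid trace_mul_sym)

text \<open>The chain rule turns the Jacobian \<open>J\<close> into \<open>c\<close> times
  \<open>matrix_inv A ** J ** A\<close>, and the trace is invariant under similarity.\<close>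

lemma trace_jacobian_conjugate:
  fixes A :: "real^'n^'n" and f :: "real^'n \<Rightarrow> real^'n"
  assumes A: "invertible A" and f: "f differentiable at (A *v x + b)"
  shows "(\<lambda>x. c *\<^sub>R (matrix_inv A *v f (A *v x + b))) differentiable at x"
    and "trace (jacobian (\<lambda>x. c *\<^sub>R (matrix_inv A *v f (A *v x + b))) (at x))
      = c * trace (jacobian f (at (A *v x + b)))"
proof -
  define J where "J = jacobian f (at (A *v x + b))"
  have "(f has_derivative (*v) J) (at (A *v x + b))"
    using f unfolding jacobian_works J_def .
  from has_derivative_compose[OF has_derivative_affine this]
  have "((\<lambda>x. c *\<^sub>R (matrix_inv A *v f (A *v x + b))) has_derivative
      (\<lambda>h. c *\<^sub>R (matrix_inv A *v (J *v (A *v h))))) (at x)"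
    by (intro has_derivative_scaleR_right bounded_linear.has_derivative[OF matrix_vector_mul_bounded_linear])
  moreover have "(\<lambda>h. c *\<^sub>R (matrix_inv A *v (J *v (A *v h)))) = (*v) (c *\<^sub>R (matrix_inv A ** J ** A))"
    by (simp add: fun_eq_iff scaleR_matrix_vector_assoc matrix_vector_mul_assoc matrix_mul_assoc)
  ultimately have D: "((\<lambda>x. c *\<^sub>R (matrix_inv A *v f (A *v x + b))) has_derivative
      (*v) (c *\<^sub>R (matrix_inv A ** J ** A))) (at x)" by simp
  then show "(\<lambda>x. c *\<^sub>R (matrix_inv A *v f (A *v x + b))) differentiable at x"
    by (auto simp: differentiable_def)
  have "trace (c *\<^sub>R B) = c * trace B" for B :: "real^'n^'n"
    by (simp add: trace_def sum_distrib_left)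
  then show "trace (jacobian (\<lambda>x. c *\<^sub>R (matrix_inv A *v f (A *v x + b))) (at x))
      = c * trace (jacobian f (at (A *v x + b)))"
    by (simp add: jacobian_eqI[OF D] trace_similar[OF A] J_def)
qed

text \<open>Freezing one block commutes with a block-diagonal map, so the conjugation argument
  applies to each block: with shift \<open>b\<close> for positions and 0 for momenta.\<close>

lemma divergence_phase_map:
  fixes A :: "real^'n^'n"
  assumes A: "invertible A" and V: "block_differentiable V (phase_map A b z)"
  shows "block_differentiable (\<lambda>z. c *\<^sub>R phase_map (matrix_inv A) 0 (V (phase_map A b z))) z"
    and "divergence (\<lambda>z. c *\<^sub>R phase_map (matrix_inv A) 0 (V (phase_map A b z))) z
      = c * divergence V (phase_map A b z)"
proof -
  have 1: "(\<lambda>x. fst (V (x, A *v snd z))) differentiable at (A *v fst z + b)"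
    and 2: "(\<lambda>y. snd (V (A *v fst z + b, y))) differentiable at (A *v snd z + 0)"
    using V by (simp_all add: block_differentiable_def phase_map_def)
  show "block_differentiable (\<lambda>z. c *\<^sub>R phase_map (matrix_inv A) 0 (V (phase_map A b z))) z"
    using trace_jacobian_conjugate(1)[OF A 1, of c] trace_jacobian_conjugate(1)[OF A 2, of c]
    by (simp add: block_differentiable_def phase_map_def)
  show "divergence (\<lambda>z. c *\<^sub>R phase_map (matrix_inv A) 0 (V (phase_map A b z))) z
      = c * divergence V (phase_map A b z)"
    using trace_jacobian_conjugate(2)[OF A 1, of c] trace_jacobian_conjugate(2)[OF A 2, of c]
    by (simp add: divergence_def phase_map_def distrib_left)
qed

text \<open>\<open>H\<close> is an arbitrary time-dependent function, since the transformed
  Hamiltonian is by definition a composition with the phase map. That map is constant in time, so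
  the time derivative acquires the same factor as the divergence.\<close>

lemma fokker_planck_solution_affine:
  fixes A :: "real^'n^'n"
  assumes A: "invertible A" and sol: "fokker_planck_solution \<gamma> H T \<rho>"
  shows "fokker_planck_solution \<gamma> (\<lambda>t z. H t (phase_map A b z)) T
    (\<lambda>t z. \<bar>det A\<bar>\<^sup>2 * \<rho> t (phase_map A b z))"
  unfolding fokker_planck_solution_def
proof (intro ballI)
  fix t assume t: "t \<in> {0<..<T}"
  let ?b' = "- (matrix_inv A *v b)" and ?\<rho> = "\<lambda>z. \<bar>det A\<bar>\<^sup>2 * \<rho> t (phase_map A b z)"
  let ?\<mu> = "density lborel (\<rho> t)"
  have pos: "\<And>z. 0 \<le> \<rho> t z" and meas: "\<rho> t \<in> borel_measurable borel" and prob: "prob_space ?\<mu>"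
    and fsm: "finite_second_moment (q_marginal ?\<mu>)" and inv: "invertible (density_covariance (\<rho> t))"
    and diff: "\<And>z. \<rho> t differentiable at z" "\<And>z. H t differentiable at z"
    and flux: "\<And>z. block_differentiable (fp_flux \<gamma> (H t) (\<rho> t)) z"
    and deriv: "\<And>z. ((\<lambda>s. \<rho> s z) has_real_derivative divergence (fp_flux \<gamma> (H t) (\<rho> t)) z) (at t)"
    using sol t by (auto simp: fokker_planck_solution_def)
  interpret prob_space ?\<mu> by fact
  have fst: "fst \<in> (borel :: ((real^'n) \<times> (real^'n)) measure) \<rightarrow>\<^sub>M borel"
    by (intro borel_measurable_continuous_onI continuous_intros)
  have dens: "density lborel ?\<rho> = distr ?\<mu> borel (phase_map (matrix_inv A) ?b')"
    using A meas by (rule density_phase_map)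
  have marg: "q_marginal (density lborel ?\<rho>) = distr (q_marginal ?\<mu>) borel (\<lambda>x. matrix_inv A *v x + ?b')"
    unfolding dens by (rule q_marginal_phase_map) simp
  have q: "prob_space (q_marginal ?\<mu>)" "sets (q_marginal ?\<mu>) = sets borel"
    using fst by (auto simp: q_marginal_def intro!: prob_space_distr)
  have cov: "density_covariance ?\<rho> = matrix_inv A ** density_covariance (\<rho> t) ** transpose (matrix_inv A)"
    unfolding density_covariance_def marg using q fsm by (rule covariance_affine)
  have flux_eq: "fp_flux \<gamma> (\<lambda>z. H t (phase_map A b z)) ?\<rho>
      = (\<lambda>z. \<bar>det A\<bar>\<^sup>2 *\<^sub>R phase_map (matrix_inv A) 0 (fp_flux \<gamma> (H t) (\<rho> t) (phase_map A b z)))"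
    using fp_flux_phase_map[OF A diff(2) diff(1) cov] by blast
  have "invertible (density_covariance ?\<rho>)"
    unfolding cov using A by (intro invertible_mult inv transpose_invertible invertible_matrix_inv)
  moreover have "?\<rho> \<in> borel_measurable borel"
    using measurable_compose[OF borel_measurable_phase_map meas] by simp
  moreover have "prob_space (density lborel ?\<rho>)"
    unfolding dens using borel_measurable_phase_map by (intro prob_space_distr) simp
  moreover have "finite_second_moment (q_marginal (density lborel ?\<rho>))"
    unfolding marg using q fsm by (rule finite_second_moment_affine)
  moreover have "?\<rho> differentiable at z" for z
    by (intro differentiable_mult differentiable_const differentiable_phase_map diff)
  moreover have "(\<lambda>z. H t (phase_map A b z)) differentiable at z" for z
    by (intro differentiable_phase_map diff)
  moreover have "((\<lambda>s. \<bar>det A\<bar>\<^sup>2 * \<rho> s (phase_map A b z)) has_real_derivative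
      divergence (fp_flux \<gamma> (\<lambda>z. H t (phase_map A b z)) ?\<rho>) z) (at t)" for z
    unfolding flux_eq divergence_phase_map(2)[OF A flux] using deriv by (rule DERIV_cmult)
  moreover have "block_differentiable (fp_flux \<gamma> (\<lambda>z. H t (phase_map A b z)) ?\<rho>) z" for z
    unfolding flux_eq using A flux by (rule divergence_phase_map(1))
  ultimately show "(\<forall>z. 0 \<le> ?\<rho> z) \<and> ?\<rho> \<in> borel_measurable borel \<and>
        prob_space (density lborel ?\<rho>) \<and>
        finite_second_moment (q_marginal (density lborel ?\<rho>)) \<and>
        invertible (density_covariance ?\<rho>) \<and>
        (\<forall>z. ?\<rho> differentiable at z \<and> (\<lambda>z. H t (phase_map A b z)) differentiable at z \<and>
             block_differentiable (fp_flux \<gamma> (\<lambda>z. H t (phase_map A b z)) ?\<rho>) z \<and>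
             ((\<lambda>s. \<bar>det A\<bar>\<^sup>2 * \<rho> s (phase_map A b z)) has_real_derivative
               divergence (fp_flux \<gamma> (\<lambda>z. H t (phase_map A b z)) ?\<rho>) z) (at t))"
    using pos by simp
qed

lemma fokker_planck_solution_affine_iff:
  fixes A :: "real^'n^'n"
  assumes A: "invertible A"
  shows "fokker_planck_solution \<gamma> H T \<rho>
    \<longleftrightarrow> fokker_planck_solution \<gamma> (\<lambda>t z. H t (phase_map A b z)) T
      (\<lambda>t z. \<bar>det A\<bar>\<^sup>2 * \<rho> t (phase_map A b z))" (is "?L \<longleftrightarrow> ?R")
proof
  assume ?L
  with A show ?R by (rule fokker_planck_solution_affine)
next
  assume R: ?R
  have inv: "invertible (matrix_inv A)" using A by (rule invertible_matrix_inv)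
  \<comment> \<open>The normalizing factors of the two successive changes of variables cancel, so
    going back returns \<open>\<rho>\<close> itself.\<close>
  have "\<bar>det (matrix_inv A)\<bar>\<^sup>2 * \<bar>det A\<bar>\<^sup>2 = 1"
    by (simp add: power_mult_distrib[symmetric] det_mul[symmetric] matrix_inv_cancel[OF A])
  then have "\<bar>det (matrix_inv A)\<bar>\<^sup>2 * (\<bar>det A\<bar>\<^sup>2 * r) = r" for r
    by (simp only: mult.assoc[symmetric] mult_1)
  with fokker_planck_solution_affine[OF inv R, of "- (matrix_inv A *v b)"] show ?L
    by (simp only: phase_map_inverse[OF A])
qed

theorem proposition4p3:
  fixes \<gamma> T :: real
    and \<Phi> :: "real^'n \<Rightarrow> real"
    and G :: "real^'n \<Rightarrow> real^'j" and y :: "real^'j"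
    and \<Gamma> :: "real^'j^'j" and \<Gamma>\<^sub>0 :: "real^'n^'n"
    and A :: "real^'n^'n" and b :: "real^'n"
    and M :: "'w measure" and F :: "real \<Rightarrow> 'w measure"
    and B :: "real \<Rightarrow> 'w \<Rightarrow> real^'m" and S :: "real \<Rightarrow> real^'m^'n"
    and v u :: "real \<Rightarrow> 'w \<Rightarrow> real^'n"
    and W :: "'i::finite \<Rightarrow> real \<Rightarrow> 'w \<Rightarrow> real^'i"
    and vs us :: "'i \<Rightarrow> real \<Rightarrow> 'w \<Rightarrow> real^'n"
    and \<rho> :: "real \<Rightarrow> (real^'n) \<times> (real^'n) \<Rightarrow> real"
  assumes "\<gamma> > 0" and "T > 0"
    and "\<forall>x. \<Phi> differentiable at x"
    and "symmetric_positive_definite \<Gamma>" and "symmetric_positive_definite \<Gamma>\<^sub>0"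
    and "invertible A"
  shows
    "(mean_field_solution \<gamma> \<Phi> S M F B T
        (\<lambda>t \<omega>. A *v v t \<omega> + b) (\<lambda>t \<omega>. A *v u t \<omega>)
      \<longleftrightarrow> mean_field_solution \<gamma> (\<lambda>x. \<Phi> (A *v x + b)) (\<lambda>t. matrix_inv A ** S t) M F B T v u)
    \<and>
     (particle_solution \<gamma> (ensemble_drift \<gamma> \<Phi>) M F W T
        (\<lambda>i t \<omega>. A *v vs i t \<omega> + b) (\<lambda>i t \<omega>. A *v us i t \<omega>)
      \<longleftrightarrow> particle_solution \<gamma> (ensemble_drift \<gamma> (\<lambda>x. \<Phi> (A *v x + b))) M F W T vs us)
    \<and>
     (particle_solution \<gamma> (gradient_free_drift \<gamma> \<Gamma> y G (\<lambda>q. matrix_inv \<Gamma>\<^sub>0 *v q)) M F W T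
        (\<lambda>i t \<omega>. A *v vs i t \<omega> + b) (\<lambda>i t \<omega>. A *v us i t \<omega>)
      \<longleftrightarrow> particle_solution \<gamma>
            (gradient_free_drift \<gamma> \<Gamma> y (\<lambda>x. G (A *v x + b))
               (gradient (\<lambda>x. regularization \<Gamma>\<^sub>0 (A *v x + b)))) M F W T vs us)
    \<and>
     (fokker_planck_solution \<gamma> (\<lambda>t. hamiltonian \<Phi> (\<rho> t)) T \<rho>
      \<longleftrightarrow> fokker_planck_solution \<gamma>
            (\<lambda>t (v', u'). hamiltonian \<Phi> (\<rho> t) (A *v v' + b, A *v u')) T
            (\<lambda>t (v', u'). \<bar>det A\<bar>\<^sup>2 * \<rho> t (A *v v' + b, A *v u')))"
proof (intro conjI)
  have \<Phi>: "\<Phi> differentiable at x" for x using assms(3) by blast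
  note A = \<open>invertible A\<close>
  show "mean_field_solution \<gamma> \<Phi> S M F B T
        (\<lambda>t \<omega>. A *v v t \<omega> + b) (\<lambda>t \<omega>. A *v u t \<omega>)
      \<longleftrightarrow> mean_field_solution \<gamma> (\<lambda>x. \<Phi> (A *v x + b)) (\<lambda>t. matrix_inv A ** S t) M F B T v u"
    using A \<Phi> by (rule mean_field_solution_affine_iff)
  show "particle_solution \<gamma> (ensemble_drift \<gamma> \<Phi>) M F W T
        (\<lambda>i t \<omega>. A *v vs i t \<omega> + b) (\<lambda>i t \<omega>. A *v us i t \<omega>)
      \<longleftrightarrow> particle_solution \<gamma> (ensemble_drift \<gamma> (\<lambda>x. \<Phi> (A *v x + b))) M F W T vs us"
    using A ensemble_drift_affine[OF \<Phi>] by (rule particle_solution_affine_iff)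
  show "particle_solution \<gamma> (gradient_free_drift \<gamma> \<Gamma> y G (\<lambda>q. matrix_inv \<Gamma>\<^sub>0 *v q)) M F W T
        (\<lambda>i t \<omega>. A *v vs i t \<omega> + b) (\<lambda>i t \<omega>. A *v us i t \<omega>)
      \<longleftrightarrow> particle_solution \<gamma>
            (gradient_free_drift \<gamma> \<Gamma> y (\<lambda>x. G (A *v x + b))
               (gradient (\<lambda>x. regularization \<Gamma>\<^sub>0 (A *v x + b)))) M F W T vs us"
    \<comment> \<open>Exposes the transformed field as \<open>transpose A *v g (A *v x + b)\<close>
      with \<open>g q = matrix_inv \<Gamma>\<^sub>0 *v q\<close>.\<close>
    unfolding gradient_regularization_affine[OF assms(5)]
    using A gradient_free_drift_affine by (rule particle_solution_affine_iff)
  show "fokker_planck_solution \<gamma> (\<lambda>t. hamiltonian \<Phi> (\<rho> t)) T \<rho>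
      \<longleftrightarrow> fokker_planck_solution \<gamma>
            (\<lambda>t (v', u'). hamiltonian \<Phi> (\<rho> t) (A *v v' + b, A *v u')) T
            (\<lambda>t (v', u'). \<bar>det A\<bar>\<^sup>2 * \<rho> t (A *v v' + b, A *v u'))"
    using fokker_planck_solution_affine_iff[OF A, of \<gamma> "\<lambda>t. hamiltonian \<Phi> (\<rho> t)" T \<rho> b]
    by (simp only: phase_map_def split_beta')
qed

end
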